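(* Let $(\Pi,\Sigma)$ be a Coxeter system, let $Q=(\sigma_1,\ldots,\sigma_m)$ be a word in $\Sigma$, and let $\pi\in\Pi$ be an element such that $Q$ contains $\pi$. Then the subword complex $\Delta(Q,\pi)$ is (homeomorphic to) either a ball or a sphere. Moreover, a face $Q\smallsetminus P$ of $\Delta(Q,\pi)$ is in the boundary of $\Delta(Q,\pi)$ if and only if $P$ has Demazure product $\delta(P)\neq\pi$.
   Context: Let $(\Pi,\Sigma)$ be a Coxeter system: $\Pi$ is a Coxeter group with set $\Sigma$ of simple reflections, and $\mathrm{length}$ is the length function with respect to $\Sigma$. A word of size $m$ is an ordered sequence $Q=(\sigma_1,\ldots,\sigma_m)$ of elements of $\Sigma$ (not necessarily a reduced expression). A subword $P$ of $Q$ is an ordered subsequence, remembered together with its positions in $Q$; thus subwords correspond to subsets of $\{1,\ldots,m\}$, subwords at different positions are different, and $Q\smallsetminus P$ denotes the subword on the complementary positions. $|P|$ is the number of positions in $P$. $P$ represents $\pi\in\Pi$ if the ordered product of the simple reflections in $P$ is a reduced decomposition of $\pi$ (so the product is $\pi$ and $|P|=\mathrm{length}(\pi)$); $P$ contains $\pi$ if some subsequence of $P$ represents $\pi$. The subword complex $\Delta(Q,\pi)$ is the simplicial complex whose faces are the subwords $Q\smallsetminus P$ whose complements $P$ contain $\pi$. Its facets are the $Q\smallsetminus P$ with $P$ representing $\pi$. Demazure product: for $\tau\in\Pi$ and $\sigma\in\Sigma$ put $\tau*\sigma=\tau\sigma$ if $\mathrm{length}(\tau\sigma)>\mathrm{length}(\tau)$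 and $\tau*\sigma=\tau$ if $\mathrm{length}(\tau\sigma)<\mathrm{length}(\tau)$. The Demazure product of a word $P=(\tau_1,\ldots,\tau_k)$ is $\delta(P)=(\cdots((1*\tau_1)*\tau_2)\cdots)*\tau_k$, where $1$ is the identity of $\Pi$. Conventions: the empty set is a face of dimension $-1$ of a simplicial complex, and the complex $\{\varnothing\}$ is regarded as a sphere of dimension $-1$ (with empty boundary). The boundary facets of the ball or sphere are the codimension $1$ faces that are contained in exactly one facet; a face lies in the boundary if it is contained in such a codimension $1$ face (in particular $\varnothing$ is a boundary face of a $0$-dimensional ball, i.e. of a single point). *)

theory Defs
  imports "HOL-Analysis.Analysis" "HOL-Algebra.Generated_Groups" "HOL-Library.Sublist"
begin

section \<open>Coxeter systems\<close>

definition word_prod :: "('a, 'b) monoid_scheme \<Rightarrow> 'a list \<Rightarrow> 'a" where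
  "word_prod G w = foldr (\<otimes>\<^bsub>G\<^esub>) w \<one>\<^bsub>G\<^esub>"

text \<open>The value \<open>m s t = 0\<close> encodes \<open>m s t = \<infinity>\<close>, i.e. no relation between \<open>s\<close> and \<open>t\<close>;
  the corresponding relator \<open>(s t)^0\<close> is the empty word.\<close>

definition coxeter_matrix :: "'a set \<Rightarrow> ('a \<Rightarrow> 'a \<Rightarrow> nat) \<Rightarrow> bool" where
  "coxeter_matrix S m \<longleftrightarrow>
     (\<forall>s\<in>S. m s s = 1) \<and>
     (\<forall>s\<in>S. \<forall>t\<in>S. s \<noteq> t \<longrightarrow> m s t = m t s \<and> m s t \<noteq> 1)"

definition coxeter_relator :: "('a \<Rightarrow> 'a \<Rightarrow> nat) \<Rightarrow> 'a \<Rightarrow> 'a \<Rightarrow> 'a list" where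
  "coxeter_relator m s t = concat (replicate (m s t) [s, t])"

definition insert_relator :: "'a set \<Rightarrow> ('a \<Rightarrow> 'a \<Rightarrow> nat) \<Rightarrow> 'a list \<Rightarrow> 'a list \<Rightarrow> bool" where
  "insert_relator S m v w \<longleftrightarrow>
     (\<exists>x\<in>lists S. \<exists>y\<in>lists S. \<exists>s\<in>S. \<exists>t\<in>S.
        v = x @ y \<and> w = x @ coxeter_relator m s t @ y)"

text \<open>\<open>G\<close> is the group presented by generators \<open>S\<close> and relators \<open>(s t)^(m s t)\<close>. Since
  \<open>s s\<close> is a relator, every generator is its own inverse, so the presented group is the quotient
  of the free monoid on \<open>S\<close> by the congruence of inserting and deleting relators; formal inverses
  are not needed. The last conjunct says that this congruence is the kernel of
  the evaluation of words in \<open>G\<close>.\<close>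

definition coxeter_system :: "('a, 'b) monoid_scheme \<Rightarrow> 'a set \<Rightarrow> bool" where
  "coxeter_system G S \<longleftrightarrow>
     group G \<and> S \<subseteq> carrier G \<and> generate G S = carrier G \<and>
     (\<exists>m. coxeter_matrix S m \<and>
       (\<forall>v\<in>lists S. \<forall>w\<in>lists S.
          word_prod G v = word_prod G w \<longleftrightarrow> equivclp (insert_relator S m) v w))"

definition coxeter_length :: "('a, 'b) monoid_scheme \<Rightarrow> 'a set \<Rightarrow> 'a \<Rightarrow> nat" where
  "coxeter_length G S x = (LEAST n. \<exists>w\<in>lists S. length w = n \<and> word_prod G w = x)"

definition represents :: "('a, 'b) monoid_scheme \<Rightarrow> 'a set \<Rightarrow> 'a list \<Rightarrow> 'a \<Rightarrow> bool" where
  "represents G S w x \<longleftrightarrow> word_prod G w = x \<and> length w = coxeter_length G S x"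

definition contains :: "('a, 'b) monoid_scheme \<Rightarrow> 'a set \<Rightarrow> 'a list \<Rightarrow> 'a \<Rightarrow> bool" where
  "contains G S w x \<longleftrightarrow> (\<exists>v. subseq v w \<and> represents G S v x)"

definition demazure_step :: "('a, 'b) monoid_scheme \<Rightarrow> 'a set \<Rightarrow> 'a \<Rightarrow> 'a \<Rightarrow> 'a" where
  "demazure_step G S x s =
     (if coxeter_length G S (x \<otimes>\<^bsub>G\<^esub> s) > coxeter_length G S x then x \<otimes>\<^bsub>G\<^esub> s else x)"

definition demazure :: "('a, 'b) monoid_scheme \<Rightarrow> 'a set \<Rightarrow> 'a list \<Rightarrow> 'a" where
  "demazure G S w = foldl (demazure_step G S) \<one>\<^bsub>G\<^esub> w"


section \<open>Abstract simplicial complexes\<close>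

text \<open>A finite abstract simplicial complex is given by its set of faces, including \<open>{}\<close>.\<close>

definition is_facet :: "'v set set \<Rightarrow> 'v set \<Rightarrow> bool" where
  "is_facet K F \<longleftrightarrow> F \<in> K \<and> (\<forall>H\<in>K. F \<subseteq> H \<longrightarrow> H = F)"

text \<open>A face \<open>F\<close> has dimension \<open>card F - 1\<close>, so \<open>F\<close> has codimension 1 iff \<open>card F + 1\<close> is the
  largest cardinality of a face.\<close>

definition is_boundary_facet :: "'v set set \<Rightarrow> 'v set \<Rightarrow> bool" where
  "is_boundary_facet K R \<longleftrightarrow>
     R \<in> K \<and> card R + 1 = Max (card ` K) \<and> (\<exists>!F. is_facet K F \<and> R \<subseteq> F)"

definition in_boundary :: "'v set set \<Rightarrow> 'v set \<Rightarrow> bool" where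
  "in_boundary K F \<longleftrightarrow> (\<exists>R. is_boundary_facet K R \<and> F \<subseteq> R)"

text \<open>Geometric realization in barycentric coordinates: the coordinates are nonnegative, sum to 1,
  and their support is a face. For finite \<open>K\<close> the product topology induces
  the usual topology.\<close>

definition realization :: "'v set set \<Rightarrow> ('v \<Rightarrow> real) topology" where
  "realization K = subtopology (powertop_real UNIV)
     {x. (\<forall>v. 0 \<le> x v) \<and> {v. x v \<noteq> 0} \<in> K \<and> (\<Sum>v | x v \<noteq> 0. x v) = 1}"

text \<open>The closed unit ball in \<open>\<real>^n\<close>; a single point for \<open>n = 0\<close>.\<close>

definition nball :: "nat \<Rightarrow> (nat \<Rightarrow> real) topology" where
  "nball n = subtopology (Euclidean_space n) {x. (\<Sum>i<n. x i ^ 2) \<le> 1}"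

definition is_ball :: "'v set set \<Rightarrow> bool" where
  "is_ball K \<longleftrightarrow> (\<exists>n. realization K homeomorphic_space nball n)"

text \<open>The complex whose only face is \<open>{}\<close> has empty realization and is the sphere of dimension -1,
  which \<^const>\<open>nsphere\<close> does not cover.\<close>

definition is_sphere :: "'v set set \<Rightarrow> bool" where
  "is_sphere K \<longleftrightarrow> K = {{}} \<or> (\<exists>n. realization K homeomorphic_space nsphere n)"


section \<open>Subword complexes\<close>

text \<open>A subword of \<open>Q\<close> is encoded by its set \<open>P\<close> of positions, counted from 0; the underlying word
  is \<open>nths Q P\<close>.\<close>

definition subword_complex :: "('a, 'b) monoid_scheme \<Rightarrow> 'a set \<Rightarrow> 'a list \<Rightarrow> 'a \<Rightarrow> nat set set" where
  "subword_complex G S Q x =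
     {{..<length Q} - P | P. P \<subseteq> {..<length Q} \<and> contains G S (nths Q P) x}"

end

theory Submission
  imports Defs
begin

text \<open>
  The proof has a topological and a combinatorial half. Both are inductions that remove the last
  letter \<open>s\<close> of a word \<open>Q @ [s]\<close> and compare \<open>w\<close> with \<open>w s\<close>.

  Topology. If \<open>w s\<close> is longer than \<open>w\<close>, then \<open>\<Delta>(Q @ [s], w)\<close> is the cone over \<open>\<Delta>(Q, w)\<close> whose apex
  is the last position. If \<open>w s\<close> is shorter, then \<open>L = \<Delta>(Q, w)\<close> is a subcomplex of \<open>D = \<Delta>(Q, w s)\<close>,
  and \<open>\<Delta>(Q @ [s], w)\<close> is \<open>D\<close> with a cone attached along \<open>L\<close>. The induction carries along that
  the boundary consists of the faces whose complementary word has Demazure product different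
  from \<open>w\<close>. It follows that \<open>L\<close> lies in the boundary of \<open>D\<close>. If \<open>L\<close> is a sphere, it is the whole
  boundary of \<open>D\<close>, and the attached cone closes the ball \<open>D\<close> up to a sphere. If \<open>L\<close> is a ball, the
  attached cone is a collar over \<open>L\<close> whose height tapers to zero at the boundary of \<open>L\<close>, and such a
  collar can be pushed into \<open>D\<close>. Gluing two topological balls along a ball in their boundaries need
  not give a ball in general; here one of them is a cone over the glued part, so that
  explicit formulas are available and no local flatness has to be discussed.

  These formulas are simplest for the cone \<open>face_cone K\<close> of all nonnegative vectors whose support is a
  face of \<open>K\<close>. A sphere corresponds to a homeomorphism of this cone with \<open>\<real>\<^sup>n\<close> that commutes with
  positive scalings, a ball to one with a half space, and the boundary of the ball to the
  bounding hyperplane. Adding a cone vertex adds one coordinate, and radial normalization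
  recovers the geometric realization. The relevant lemmas are \<open>cone_sphere\<close>, \<open>cone_ball\<close>,
  \<open>ball_Un_cone_boundary\<close> and \<open>ball_Un_cone_ball\<close>, assembled in \<open>subword_complex_ball_or_sphere\<close>.

  Combinatorics. Counting, modulo 2, how often a reflection arises from a letter of a word gives a
  function that is constant on the classes of the Coxeter congruence, since it is even
  on relators. This yields the strong exchange condition directly from the presentation
  (\<open>shorter_iff_odd_refl_count\<close>). From it, \<open>contains_cover\<close> shows that a word \<open>P\<close>
  containing \<open>w\<close> with \<open>\<delta>(P) \<noteq> w\<close> has a reduced subword that is longer by one letter and still contains
  \<open>w\<close>; hence \<open>\<delta>(P)\<close> is the unique longest element that \<open>P\<close> contains. A codimension 1 face has a
  complement \<open>P\<close> with one letter more than \<open>w\<close>, and the facets above it are the letters whose deletion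
  from \<open>P\<close> leaves a word for \<open>w\<close>. Their number is a reflection count of \<open>P\<close>, which is 1 if \<open>P\<close> is
  reduced and even otherwise. So the boundary facets are the complements of the reduced subwords
  with one letter more than \<open>w\<close> that contain \<open>w\<close>, and \<open>contains_cover\<close> identifies
  the faces below them.
\<close>

section \<open>Subwords of lists\<close>

lemma card_eq_1_iff_ex1: "card {i. P i} = 1 \<longleftrightarrow> (\<exists>!i. P i)"
  unfolding One_nat_def card_1_singleton_iff Ex1_def set_eq_iff by auto

lemma subseq_one_shorter:
  assumes "subseq u T" "length T = Suc (length u)"
  shows "\<exists>y b z. T = y @ b # z \<and> u = y @ z"
  using assms
proof (induction rule: list_emb.induct)
  case (list_emb_Nil ys)
  then obtain b where "ys = [b]" by (cases ys) auto
  then show ?case by (intro exI[of _ "[]"]) auto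
next
  case (list_emb_Cons u T b)
  then have "u = T" by (simp add: subseq_same_length)
  then show ?case by (intro exI[of _ "[]"]) auto
next
  case (list_emb_Cons2 a a' u T)
  then obtain y b z where "T = y @ b # z" "u = y @ z" by auto
  then show ?case using list_emb_Cons2.hyps by (intro exI[of _ "a # y"]) auto
qed

lemma subseq_snoc_iff:
  "subseq v (P @ [s]) \<longleftrightarrow> subseq v P \<or> (\<exists>u. v = u @ [s] \<and> subseq u P)"
proof
  assume "subseq v (P @ [s])"
  then obtain u u' where "v = u @ u'" "subseq u P" "subseq u' [s]"
    by (auto simp: subseq_append_iff)
  then show "subseq v P \<or> (\<exists>u. v = u @ [s] \<and> subseq u P)"
    by (cases u') (auto split: if_splits)
qed auto

lemma nths_restrict: "nths Q A = nths Q (A \<inter> {..<length Q})"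
  unfolding nths_def by (intro arg_cong[where f = "map fst"] filter_cong) (auto simp: set_zip)

lemma nths_cong: "A \<inter> {..<length Q} = B \<inter> {..<length Q} \<Longrightarrow> nths Q A = nths Q B"
  using nths_restrict[of Q A] nths_restrict[of Q B] by simp

lemma subseq_nths_mono: "A \<subseteq> B \<Longrightarrow> subseq (nths Q A) (nths Q B)"
proof (induction Q arbitrary: A B)
  case (Cons q Q)
  have "subseq (nths Q {j. Suc j \<in> A}) (nths Q {j. Suc j \<in> B})"
    using Cons by (intro Cons.IH) auto
  then show ?case using Cons.prems by (auto simp: nths_Cons)
qed simp

lemma nths_snoc: "nths (Q @ [s]) A = nths Q A @ (if length Q \<in> A then [s] else [])"
  by (simp add: nths_append)

text \<open>A position of \<open>nths Q A\<close> is not a position of \<open>Q\<close>. The function \<open>e\<close> translates between the two, so that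
  deleting a letter from the subword becomes removing an element from \<open>A\<close>.\<close>

lemma nths_delete_enumeration:
  obtains e where "bij_betw e {..<length (nths Q A)} (A \<inter> {..<length Q})"
    and "\<And>i. i < length (nths Q A) \<Longrightarrow>
      nths Q (A - {e i}) = take i (nths Q A) @ drop (Suc i) (nths Q A)"
proof -
  have "\<exists>e. bij_betw e {..<length (nths Q A)} (A \<inter> {..<length Q}) \<and>
    (\<forall>i<length (nths Q A). nths Q (A - {e i}) = take i (nths Q A) @ drop (Suc i) (nths Q A))"
  proof (induction Q rule: rev_induct)
    case (snoc s Q)
    define v where "v = nths Q A"
    define l where "l = length v"
    obtain e where e: "bij_betw e {..<l} (A \<inter> {..<length Q})"
      and del: "\<And>i. i < l \<Longrightarrow> nths Q (A - {e i}) = take i v @ drop (Suc i) v"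
      using snoc.IH unfolding l_def v_def by blast
    have lt: "e i < length Q" if "i < l" for i using bij_betwE[OF e] that by auto
    show ?case
    proof (cases "length Q \<in> A")
      case False
      then have "A \<inter> {..<length (Q @ [s])} = A \<inter> {..<length Q}" by (auto simp: less_Suc_eq)
      then show ?thesis using e del False
        by (intro exI[of _ e]) (simp add: nths_snoc flip: v_def l_def)
    next
      case True
      define e' where "e' = e(l := length Q)"
      have v': "nths (Q @ [s]) A = v @ [s]" using True by (simp add: nths_snoc v_def)
      have "bij_betw e' {..<l} (A \<inter> {..<length Q})"
        using e by (rule bij_betw_cong[THEN iffD1, rotated]) (auto simp: e'_def)
      moreover have "bij_betw e' {l} {length Q}" by (simp add: e'_def)
      ultimately have "bij_betw e' ({..<l} \<union> {l}) (A \<inter> {..<length Q} \<union> {length Q})"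
        by (rule bij_betw_combine) auto
      moreover have "{..<l} \<union> {l} = {..<length (nths (Q @ [s]) A)}"
        "A \<inter> {..<length Q} \<union> {length Q} = A \<inter> {..<length (Q @ [s])}"
        using True v' by (auto simp: l_def)
      ultimately have "bij_betw e' {..<length (nths (Q @ [s]) A)} (A \<inter> {..<length (Q @ [s])})"
        by simp
      moreover have "nths (Q @ [s]) (A - {e' i}) = take i (v @ [s]) @ drop (Suc i) (v @ [s])"
        if "i < Suc l" for i
      proof (cases "i = l")
        case True
        moreover have "nths Q (A - {length Q}) = v" unfolding v_def by (rule nths_cong) auto
        ultimately show ?thesis by (simp add: nths_snoc e'_def l_def)
      next
        case False
        then have i: "i < l" using that by simp
        then have "length Q \<in> A - {e' i}" using lt[OF i] True False by (simp add: e'_def)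
        then show ?thesis using del[OF i] i by (simp add: nths_snoc e'_def l_def)
      qed
      ultimately show ?thesis unfolding v' by (intro exI[of _ e']) (simp add: l_def)
    qed
  qed (auto simp: bij_betw_def)
  then show thesis using that by blast
qed

section \<open>Coxeter groups: lengths and the exchange condition\<close>

locale coxeter_group = group G for G :: "('a, 'b) monoid_scheme" (structure) +
  fixes S :: "'a set" and m :: "'a \<Rightarrow> 'a \<Rightarrow> nat"
  assumes S_subset: "S \<subseteq> carrier G"
    and generate_S: "generate G S = carrier G"
    and coxeter_matrix: "coxeter_matrix S m"
    and presentation: "\<lbrakk>v \<in> lists S; w \<in> lists S\<rbrakk> \<Longrightarrow>
      word_prod G v = word_prod G w \<longleftrightarrow> equivclp (insert_relator S m) v w"
begin

abbreviation wp :: "'a list \<Rightarrow> 'a" where "wp \<equiv> word_prod G"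
abbreviation len :: "'a \<Rightarrow> nat" where "len \<equiv> coxeter_length G S"

lemma S_carrier [simp, intro]: "s \<in> S \<Longrightarrow> s \<in> carrier G"
  using S_subset by blast

lemma wp_Nil [simp]: "wp [] = \<one>"
  by (simp add: word_prod_def)

lemma wp_Cons [simp]: "wp (s # w) = s \<otimes> wp w"
  by (simp add: word_prod_def)

lemma wp_closed [simp, intro]: "w \<in> lists S \<Longrightarrow> wp w \<in> carrier G"
  by (induction w) auto

lemma wp_append: "\<lbrakk>v \<in> lists S; w \<in> lists S\<rbrakk> \<Longrightarrow> wp (v @ w) = wp v \<otimes> wp w"
  by (induction v) (auto simp: m_assoc)

lemma wp_snoc: "\<lbrakk>v \<in> lists S; s \<in> S\<rbrakk> \<Longrightarrow> wp (v @ [s]) = wp v \<otimes> s"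
  by (simp add: wp_append)

lemma relator_in_lists: "\<lbrakk>s \<in> S; t \<in> S\<rbrakk> \<Longrightarrow> coxeter_relator m s t \<in> lists S"
  by (auto simp: coxeter_relator_def split: if_splits)

lemma wp_relator:
  assumes "s \<in> S" "t \<in> S"
  shows "wp (coxeter_relator m s t) = \<one>"
proof -
  have l: "coxeter_relator m s t \<in> lists S"
    using assms relator_in_lists by blast
  have "insert_relator S m [] (coxeter_relator m s t)"
    using assms unfolding insert_relator_def by force
  then have "wp [] = wp (coxeter_relator m s t)"
    using presentation l by (meson lists.Nil r_into_equivclp)
  then show ?thesis by simp
qed

lemma S_square [simp]:
  assumes "s \<in> S" shows "s \<otimes> s = \<one>"
  using wp_relator[OF assms assms] coxeter_matrix assms
  by (simp add: coxeter_relator_def coxeter_matrix_def)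

lemma inv_S [simp]: "s \<in> S \<Longrightarrow> inv s = s"
  by (simp add: inv_equality)

lemma S_cancel_left [simp]: "\<lbrakk>s \<in> S; x \<in> carrier G\<rbrakk> \<Longrightarrow> s \<otimes> (s \<otimes> x) = x"
  by (simp flip: m_assoc)

lemma S_cancel_right [simp]: "\<lbrakk>s \<in> S; x \<in> carrier G\<rbrakk> \<Longrightarrow> x \<otimes> s \<otimes> s = x"
  by (simp add: m_assoc)

lemma inv_cancel_left [simp]:
  "\<lbrakk>x \<in> carrier G; y \<in> carrier G\<rbrakk> \<Longrightarrow> inv x \<otimes> (x \<otimes> y) = y"
  "\<lbrakk>x \<in> carrier G; y \<in> carrier G\<rbrakk> \<Longrightarrow> x \<otimes> (inv x \<otimes> y) = y"
  by (simp_all flip: m_assoc)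

lemma ex_word:
  assumes "x \<in> carrier G"
  shows "\<exists>w\<in>lists S. wp w = x"
proof -
  have "x \<in> generate G S" using assms generate_S by simp
  then show ?thesis
  proof induction
    case one
    then show ?case by (intro bexI[of _ "[]"]) auto
  next
    case (incl h)
    then show ?case by (intro bexI[of _ "[h]"]) auto
  next
    case (inv h)
    then show ?case by (intro bexI[of _ "[h]"]) auto
  next
    case (eng g h)
    then obtain v w where "v \<in> lists S" "wp v = g" "w \<in> lists S" "wp w = h" by blast
    then show ?case by (intro bexI[of _ "v @ w"]) (auto simp: wp_append)
  qed
qed

lemma reduced_word_exists:
  assumes "x \<in> carrier G"
  obtains w where "w \<in> lists S" "wp w = x" "length w = len x"
proof -
  have "\<exists>n. \<exists>w\<in>lists S. length w = n \<and> wp w = x" using ex_word[OF assms] by blast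
  then have "\<exists>w\<in>lists S. length w = len x \<and> wp w = x"
    unfolding coxeter_length_def by (rule LeastI_ex)
  then show thesis using that by blast
qed

lemma len_le: "w \<in> lists S \<Longrightarrow> len (wp w) \<le> length w"
  unfolding coxeter_length_def by (rule Least_le) blast

text \<open>The presentation enters the proof only through \<open>wp_relator\<close> and this induction principle: a quantity
  that ignores the insertion of relators is a function of the group element.\<close>

lemma relation_invariant:
  assumes step: "\<And>x y s t. \<lbrakk>x \<in> lists S; y \<in> lists S; s \<in> S; t \<in> S\<rbrakk> \<Longrightarrow>
      f (x @ coxeter_relator m s t @ y) = f (x @ y)"
    and vw: "v \<in> lists S" "w \<in> lists S" "wp v = wp w"
  shows "f v = f w"
proof -
  have "equivclp (insert_relator S m) v w" using presentation vw by blast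
  then show ?thesis
  proof (induction rule: equivclp_induct)
    case (step y z)
    have "f p = f q" if "insert_relator S m p q" for p q
      using that unfolding insert_relator_def by (elim bexE conjE) (simp only: assms(1))
    then show ?case using step by metis
  qed simp
qed

lemma even_length_relator: "even (length (coxeter_relator m s t))"
  by (auto simp: coxeter_relator_def length_concat sum_list_replicate)

lemma length_parity:
  assumes "v \<in> lists S" "w \<in> lists S" "wp v = wp w"
  shows "even (length v) = even (length w)"
  by (rule relation_invariant[OF _ assms]) (use even_length_relator in auto)

lemma even_len_iff: "w \<in> lists S \<Longrightarrow> even (len (wp w)) \<longleftrightarrow> even (length w)"
  by (metis length_parity reduced_word_exists wp_closed)

lemma len_mult_S_parity:
  assumes "x \<in> carrier G" "s \<in> S"
  shows "even (len (x \<otimes> s)) \<longleftrightarrow> odd (len x)"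
proof -
  obtain w where w: "w \<in> lists S" "wp w = x" "length w = len x"
    using reduced_word_exists assms by blast
  then show ?thesis
    using even_len_iff[of "w @ [s]"] even_len_iff[of w] assms by (simp add: wp_snoc)
qed

lemma len_mult_S_le:
  assumes "x \<in> carrier G" "s \<in> S"
  shows "len (x \<otimes> s) \<le> Suc (len x)"
proof -
  obtain w where w: "w \<in> lists S" "wp w = x" "length w = len x"
    using reduced_word_exists assms by blast
  then show ?thesis using len_le[of "w @ [s]"] assms by (simp add: wp_snoc)
qed

lemma len_mult_S_cases:
  assumes "x \<in> carrier G" "s \<in> S"
  obtains (up) "len (x \<otimes> s) = Suc (len x)" | (down) "len x = Suc (len (x \<otimes> s))"
proof -
  have "len x \<le> Suc (len (x \<otimes> s))"
    using len_mult_S_le[of "x \<otimes> s" s] assms by simp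
  then show thesis
    using len_mult_S_le[OF assms] len_mult_S_parity[OF assms] that
    by (cases "len (x \<otimes> s) = len x") (auto simp: le_Suc_eq)
qed

lemma len_mult_S_down: "\<lbrakk>x \<in> carrier G; s \<in> S; \<not> len x < len (x \<otimes> s)\<rbrakk> \<Longrightarrow> len x = Suc (len (x \<otimes> s))"
  by (rule len_mult_S_cases[of x s]) auto

text \<open>A letter \<open>s\<close> of a word is associated with the reflection \<open>inv y s y\<close>, where \<open>y\<close> is the product of the
  letters to its right. The equation \<open>s y = y t\<close> compares this reflection with \<open>t\<close> without an
  inverse.\<close>

fun refl_count :: "'a list \<Rightarrow> 'a \<Rightarrow> nat" where
  "refl_count [] t = 0"
| "refl_count (s # w) t = of_bool (s \<otimes> wp w = wp w \<otimes> t) + refl_count w t"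

text \<open>The count is a cocycle: the prefix \<open>v\<close> sees the reflection conjugated by the suffix \<open>w\<close>.\<close>

lemma refl_count_append:
  assumes "v \<in> lists S" "w \<in> lists S" "t \<in> carrier G"
  shows "refl_count (v @ w) t = refl_count v (wp w \<otimes> t \<otimes> inv wp w) + refl_count w t"
  using assms(1)
proof (induction v)
  case (Cons s v)
  have c: "wp v \<in> carrier G" "wp w \<in> carrier G" "s \<in> carrier G" using Cons assms by auto
  have "s \<otimes> wp v = wp v \<otimes> (wp w \<otimes> t \<otimes> inv wp w) \<longleftrightarrow>
     s \<otimes> wp v \<otimes> wp w = wp v \<otimes> (wp w \<otimes> t \<otimes> inv wp w) \<otimes> wp w"
    using c assms by simp
  also have "\<dots> \<longleftrightarrow> s \<otimes> (wp v \<otimes> wp w) = wp v \<otimes> wp w \<otimes> t"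
    using c assms by (simp add: m_assoc)
  finally show ?case using Cons assms by (simp add: wp_append)
qed simp

lemma wp_alternating:
  assumes "s \<in> S" "t \<in> S"
  shows "wp (concat (replicate k [s, t])) = (s \<otimes> t) [^] k"
proof (induction k)
  case (Suc k)
  then show ?case
    using assms nat_pow_Suc2[of "s \<otimes> t" k] by (simp add: m_assoc)
qed simp

text \<open>The letters of \<open>(s t)\<^sup>k\<close>, read from the right, give the reflections \<open>t (s t)\<^sup>j\<close>, \<open>j < 2 k\<close>.\<close>

lemma refl_count_alternating:
  assumes st: "s \<in> S" "t \<in> S" and u: "u \<in> carrier G"
  shows "refl_count (concat (replicate k [s, t])) u = (\<Sum>j<2*k. of_bool (u = t \<otimes> (s \<otimes> t) [^] j))"
proof (induction k)
  case (Suc k)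
  define c where "c = s \<otimes> t"
  have c: "c \<in> carrier G" using st by (auto simp: c_def)
  \<comment> \<open>Conjugation by \<open>t\<close> inverts the rotation \<open>c\<close>.\<close>
  have conj: "c [^] k \<otimes> (t \<otimes> c [^] k) = t" for k :: nat
  proof (induction k)
    case (Suc k)
    have "c [^] Suc k \<otimes> (t \<otimes> c [^] Suc k) = c [^] k \<otimes> (c \<otimes> t \<otimes> c) \<otimes> c [^] k"
      using c st by (subst (2) nat_pow_Suc2) (simp_all add: m_assoc)
    also have "c \<otimes> t \<otimes> c = t" using st by (simp add: c_def m_assoc)
    finally show ?case using Suc c st by (simp add: m_assoc)
  qed (use st in simp)
  have 1: "t \<otimes> c [^] k = c [^] k \<otimes> u \<longleftrightarrow> u = t \<otimes> c [^] (2 * k)"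
  proof -
    have "c [^] k \<otimes> (t \<otimes> c [^] (2 * k)) = t \<otimes> c [^] k"
      using conj[of k] c st nat_pow_mult[OF c, of k k]
      by (metis S_carrier m_assoc m_closed mult_2 nat_pow_closed)
    then have "t \<otimes> c [^] k = c [^] k \<otimes> u \<longleftrightarrow> c [^] k \<otimes> (t \<otimes> c [^] (2 * k)) = c [^] k \<otimes> u"
      by simp
    also have "\<dots> \<longleftrightarrow> u = t \<otimes> c [^] (2 * k)"
      using c st u by (subst Units_l_cancel) auto
    finally show ?thesis .
  qed
  have 2: "s \<otimes> (t \<otimes> c [^] k) = (t \<otimes> c [^] k) \<otimes> u \<longleftrightarrow> u = t \<otimes> c [^] (Suc (2 * k))"
  proof -
    have "c [^] (Suc (2 * k)) = c [^] k \<otimes> c [^] Suc k"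
      using nat_pow_mult[OF c, of k "Suc k"] by (simp add: mult_2 del: nat_pow_Suc)
    then have "(t \<otimes> c [^] k) \<otimes> (t \<otimes> c [^] (Suc (2 * k))) = t \<otimes> (c [^] k \<otimes> (t \<otimes> c [^] k)) \<otimes> c [^] Suc k"
      using c st by (simp add: m_assoc del: nat_pow_Suc)
    also have "\<dots> = c [^] Suc k" using st c by (simp add: conj del: nat_pow_Suc)
    also have "\<dots> = s \<otimes> (t \<otimes> c [^] k)" using c st nat_pow_Suc2[OF c, of k] by (simp add: c_def m_assoc)
    finally have "s \<otimes> (t \<otimes> c [^] k) = (t \<otimes> c [^] k) \<otimes> u \<longleftrightarrow>
       (t \<otimes> c [^] k) \<otimes> (t \<otimes> c [^] (Suc (2 * k))) = (t \<otimes> c [^] k) \<otimes> u" by simp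
    also have "\<dots> \<longleftrightarrow> u = t \<otimes> c [^] (Suc (2 * k))"
      using c st u by (subst Units_l_cancel) (auto simp del: nat_pow_Suc)
    finally show ?thesis .
  qed
  show ?case
    using Suc 1 2 st by (simp add: wp_alternating del: nat_pow_Suc flip: c_def)
qed simp

text \<open>For \<open>(s t)\<^sup>p = 1\<close> the sequence \<open>t (s t)\<^sup>j\<close>, \<open>j < 2 p\<close>, runs through the same \<open>p\<close> values twice.\<close>

lemma even_refl_count_relator:
  assumes st: "s \<in> S" "t \<in> S" and u: "u \<in> carrier G"
  shows "even (refl_count (coxeter_relator m s t) u)"
proof -
  define p where "p = m s t"
  define f where "f j = (of_bool (u = t \<otimes> (s \<otimes> t) [^] j) :: nat)" for j :: nat
  have "(s \<otimes> t) [^] p = \<one>"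
    using wp_relator[OF st] wp_alternating[OF st] by (simp add: coxeter_relator_def p_def)
  then have f: "f (j + p) = f j" for j
    using st by (simp add: f_def flip: nat_pow_mult)
  have "refl_count (coxeter_relator m s t) u = (\<Sum>j<2*p. f j)"
    using refl_count_alternating[OF st u] by (simp add: coxeter_relator_def p_def f_def)
  also have "\<dots> = (\<Sum>j<p. f j) + (\<Sum>j=p..<p+p. f j)"
    by (simp add: mult_2 lessThan_atLeast0 sum.atLeastLessThan_concat)
  also have "(\<Sum>j=p..<p+p. f j) = (\<Sum>j<p. f (j + p))"
    using sum.shift_bounds_nat_ivl[of f 0 p p] by (simp add: lessThan_atLeast0)
  finally show ?thesis by (simp add: f)
qed

lemma refl_count_parity:
  assumes "v \<in> lists S" "w \<in> lists S" "wp v = wp w" "t \<in> carrier G"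
  shows "even (refl_count v t) = even (refl_count w t)"
proof (rule relation_invariant[OF _ assms(1-3)])
  fix x y a b assume *: "x \<in> lists S" "y \<in> lists S" "a \<in> S" "b \<in> S"
  let ?r = "coxeter_relator m a b"
  have r: "?r \<in> lists S" using * relator_in_lists by blast
  have "wp (?r @ y) = wp y" using r * by (simp add: wp_append wp_relator)
  then show "even (refl_count (x @ ?r @ y) t) = even (refl_count (x @ y) t)"
    using * r assms(4) even_refl_count_relator
    by (simp add: refl_count_append[of x] refl_count_append[of ?r y])
qed

abbreviation delete_nth :: "nat \<Rightarrow> 'c list \<Rightarrow> 'c list" where
  "delete_nth i w \<equiv> take i w @ drop (Suc i) w"

lemma delete_nth_in_lists: "w \<in> lists S \<Longrightarrow> delete_nth i w \<in> lists S"
  by (auto dest: in_set_takeD in_set_dropD)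

text \<open>A letter gives rise to the reflection \<open>t\<close> exactly if deleting it multiplies the product by \<open>t\<close>. This turns
  the parity invariant into statements about deletions.\<close>

lemma refl_count_eq_card:
  assumes "w \<in> lists S" "t \<in> carrier G"
  shows "refl_count w t = card {i. i < length w \<and> wp (delete_nth i w) = wp w \<otimes> t}"
  using assms(1)
proof (induction w)
  case (Cons s w)
  let ?A = "\<lambda>w. {i. i < length w \<and> wp (delete_nth i w) = wp w \<otimes> t}"
  have s: "s \<in> S" and w: "w \<in> lists S" using Cons by auto
  have "?A (s # w) = (if s \<otimes> wp w = wp w \<otimes> t then {0} else {}) \<union> Suc ` ?A w"
  proof (intro Set.set_eqI)
    fix i :: nat
    show "i \<in> ?A (s # w) \<longleftrightarrow> i \<in> (if s \<otimes> wp w = wp w \<otimes> t then {0} else {}) \<union> Suc ` ?A w"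
    proof (cases i)
      case 0
      have "wp w = s \<otimes> wp w \<otimes> t \<longleftrightarrow> s \<otimes> wp w = s \<otimes> (s \<otimes> wp w \<otimes> t)"
        using s w assms by simp
      also have "\<dots> \<longleftrightarrow> s \<otimes> wp w = wp w \<otimes> t"
        using s w assms by (simp add: m_assoc)
      finally show ?thesis using 0 by auto
    next
      case (Suc j)
      have "s \<otimes> wp (delete_nth j w) = s \<otimes> wp w \<otimes> t \<longleftrightarrow> wp (delete_nth j w) = wp w \<otimes> t"
        using s w assms delete_nth_in_lists[OF w, of j] by (simp add: m_assoc)
      then show ?thesis using Suc by auto
    qed
  qed
  moreover have "card (Suc ` ?A w) = card (?A w)" by (simp add: card_image)
  ultimately show ?case using Cons by (auto simp: card_insert_if)
qed simp

lemma odd_refl_count_imp_deletion: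
  assumes "w \<in> lists S" "t \<in> carrier G" "odd (refl_count w t)"
  obtains i where "i < length w" "wp (delete_nth i w) = wp w \<otimes> t"
proof -
  have "card {i. i < length w \<and> wp (delete_nth i w) = wp w \<otimes> t} \<noteq> 0"
    using assms(3) unfolding refl_count_eq_card[OF assms(1,2)] by (metis even_zero)
  then have "{i. i < length w \<and> wp (delete_nth i w) = wp w \<otimes> t} \<noteq> {}"
    by (metis card.empty)
  then show thesis using that by blast
qed

lemma odd_refl_count_imp_shorter:
  assumes "w \<in> lists S" "t \<in> carrier G" "odd (refl_count w t)"
  shows "len (wp w \<otimes> t) < len (wp w)"
proof -
  obtain v where v: "v \<in> lists S" "wp v = wp w" "length v = len (wp w)"
    using reduced_word_exists assms by blast
  then have "odd (refl_count v t)" using refl_count_parity[of w v t] assms by simp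
  then obtain i where i: "i < length v" "wp (delete_nth i v) = wp v \<otimes> t"
    using odd_refl_count_imp_deletion[OF v(1) assms(2)] by blast
  have "len (wp (delete_nth i v)) \<le> length (delete_nth i v)"
    using len_le delete_nth_in_lists v by blast
  then show ?thesis using i v by auto
qed

definition reflection :: "'a \<Rightarrow> bool" where
  "reflection t \<longleftrightarrow> (\<exists>z\<in>carrier G. \<exists>s\<in>S. t = z \<otimes> s \<otimes> inv z)"

lemma reflection_closed: "reflection t \<Longrightarrow> t \<in> carrier G"
  by (auto simp: reflection_def)

lemma reflection_S: "s \<in> S \<Longrightarrow> reflection s"
  unfolding reflection_def by (rule bexI[of _ \<one>], rule bexI[of _ s]) auto

lemma reflection_conj:
  assumes "reflection t" "y \<in> carrier G" shows "reflection (y \<otimes> t \<otimes> inv y)"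
proof -
  obtain z s where zs: "z \<in> carrier G" "s \<in> S" "t = z \<otimes> s \<otimes> inv z"
    using assms by (auto simp: reflection_def)
  then have "y \<otimes> t \<otimes> inv y = (y \<otimes> z) \<otimes> s \<otimes> inv (y \<otimes> z)"
    using assms by (simp add: m_assoc inv_mult_group)
  then show ?thesis using zs assms unfolding reflection_def by blast
qed

lemma reflection_square: "reflection t \<Longrightarrow> t \<otimes> t = \<one>"
proof -
  assume "reflection t"
  then obtain z s where zs: "z \<in> carrier G" "s \<in> S" "t = z \<otimes> s \<otimes> inv z"
    by (auto simp: reflection_def)
  have "t \<otimes> t = z \<otimes> (s \<otimes> (inv z \<otimes> z) \<otimes> s) \<otimes> inv z"
    unfolding zs(3) using zs by (simp add: m_assoc del: l_inv S_square)
  also have "\<dots> = \<one>" using zs by simp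
  finally show ?thesis .
qed

lemma wp_rev: "w \<in> lists S \<Longrightarrow> wp (rev w) = inv (wp w)"
proof (induction w)
  case (Cons s w)
  then have "rev w \<in> lists S" by (simp add: in_lists_conv_set)
  then show ?case using Cons wp_snoc[of "rev w" s] by (simp add: inv_mult_group)
qed simp

text \<open>If \<open>t\<close> is conjugate to \<open>s\<close> by the product of \<open>w\<close>, the palindrome \<open>w @ s # rev w\<close> is a word for
  \<open>t\<close>. Its two outer halves contribute the same parity, because \<open>w @ rev w\<close> is trivial, and its
  middle letter contributes one.\<close>

lemma refl_count_palindrome:
  assumes "reflection t"
  obtains r where "r \<in> lists S" "wp r = t" "odd (refl_count r t)"
proof -
  obtain z s where zs: "z \<in> carrier G" "s \<in> S" "t = z \<otimes> s \<otimes> inv z"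
    using assms by (auto simp: reflection_def)
  obtain w where w: "w \<in> lists S" "wp w = z" using ex_word zs by blast
  have t: "t \<in> carrier G" using zs by auto
  have rw: "rev w \<in> lists S" "wp (rev w) = inv z" using w wp_rev by auto
  have conj1: "inv z \<otimes> t \<otimes> inv (inv z) = s"
    using zs by (simp add: m_assoc)
  have conj2: "(s \<otimes> inv z) \<otimes> t \<otimes> inv (s \<otimes> inv z) = s"
  proof -
    have "(s \<otimes> inv z) \<otimes> t \<otimes> inv (s \<otimes> inv z) = s \<otimes> (inv z \<otimes> t \<otimes> inv (inv z)) \<otimes> s"
      using zs by (simp add: m_assoc inv_mult_group)
    then show ?thesis using conj1 zs by simp
  qed
  have eq: "s \<otimes> inv z = inv z \<otimes> t"
    using zs by (simp add: m_assoc)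
  have "refl_count (w @ rev w) t = refl_count w s + refl_count (rev w) t"
    using refl_count_append[OF w(1) rw(1) t] conj1 rw by simp
  moreover have "even (refl_count (w @ rev w) t)"
    using refl_count_parity[of "w @ rev w" "[]" t] w rw zs t by (simp add: wp_append)
  moreover have "refl_count (w @ s # rev w) t = refl_count w s + (1 + refl_count (rev w) t)"
    using refl_count_append[of w "s # rev w" t] w rw zs t conj2 eq by simp
  ultimately have "odd (refl_count (w @ s # rev w) t)" by presburger
  moreover have "wp (w @ s # rev w) = t"
    using w rw zs by (simp add: wp_append m_assoc)
  ultimately show thesis using that[of "w @ s # rev w"] w rw zs by simp
qed

text \<open>If the count of \<open>w\<close> is odd, a letter of a reduced word can be deleted. Otherwise, as \<open>t\<close> has an odd count
  on itself, the cocycle rule makes the count odd on \<open>w t\<close>, so that \<open>w = (w t) t\<close> is the shorter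
  element.\<close>

lemma shorter_iff_odd_refl_count:
  assumes w: "w \<in> lists S" and t: "reflection t"
  shows "len (wp w \<otimes> t) < len (wp w) \<longleftrightarrow> odd (refl_count w t)"
proof
  assume less: "len (wp w \<otimes> t) < len (wp w)"
  have tc: "t \<in> carrier G" using t reflection_closed by blast
  obtain v where v: "v \<in> lists S" "wp v = wp w \<otimes> t"
    using ex_word w tc by (metis m_closed wp_closed)
  obtain r where r: "r \<in> lists S" "wp r = t" "odd (refl_count r t)"
    using refl_count_palindrome t by blast
  have vt: "wp v \<otimes> t = wp w"
    using v w tc reflection_square[OF t] by (simp add: m_assoc)
  have "\<not> odd (refl_count v t)"
    using odd_refl_count_imp_shorter[OF v(1) tc] less v vt by auto
  moreover have "refl_count (v @ r) t = refl_count v t + refl_count r t"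
    using refl_count_append[OF v(1) r(1) tc] r tc by (simp add: m_assoc)
  moreover have "even (refl_count (v @ r) t) = even (refl_count w t)"
    using refl_count_parity[of "v @ r" w t] v r w tc vt by (simp add: wp_append)
  ultimately show "odd (refl_count w t)" using r by simp
qed (use assms odd_refl_count_imp_shorter reflection_closed in blast)

lemma strong_exchange:
  assumes "w \<in> lists S" "reflection t" "len (wp w \<otimes> t) < len (wp w)"
  obtains i where "i < length w" "wp (delete_nth i w) = wp w \<otimes> t"
  using assms shorter_iff_odd_refl_count odd_refl_count_imp_deletion reflection_closed by metis

text \<open>Strong exchange applies to a reduced word of \<open>x\<close> followed by \<open>s\<close> and the reflection \<open>s t s\<close>. The
  deleted letter cannot lie in the word of \<open>x\<close>, since \<open>x t\<close> is longer than \<open>x\<close>; hence it is the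
  last letter, whose reflection is \<open>s\<close>, and \<open>s t s = s\<close>.\<close>

lemma lifting_cover:
  assumes x: "x \<in> carrier G" and t: "reflection t" and s: "s \<in> S"
    and cover: "len (x \<otimes> t) = Suc (len x)"
    and up: "len x < len (x \<otimes> s)" and down: "len (x \<otimes> t \<otimes> s) < len (x \<otimes> t)"
  shows "t = s"
proof -
  obtain w where w: "w \<in> lists S" "wp w = x" "length w = len x"
    using reduced_word_exists x by blast
  define r where "r = s \<otimes> t \<otimes> inv s"
  have tc: "t \<in> carrier G" using t reflection_closed by blast
  have r: "reflection r" unfolding r_def using reflection_conj[OF t, of s] s by blast
  have "wp (w @ [s]) \<otimes> r = x \<otimes> t \<otimes> s"
    using w s x tc by (simp add: wp_snoc r_def) (simp add: m_assoc)
  moreover have "wp (w @ [s]) = x \<otimes> s" using w s by (simp add: wp_snoc)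
  ultimately have "odd (refl_count (w @ [s]) r)"
    using shorter_iff_odd_refl_count[of "w @ [s]" r] w s r down up cover by simp
  moreover have t_eq: "s \<otimes> r \<otimes> inv s = t"
    using s tc by (simp add: r_def m_assoc)
  ultimately have "odd (refl_count w t + refl_count [s] r)"
    using refl_count_append[of w "[s]" r] w s reflection_closed[OF r] by simp
  moreover have "even (refl_count w t)"
    using shorter_iff_odd_refl_count[OF w(1) t] w cover by simp
  ultimately have "s = r" using s reflection_closed[OF r] by (auto split: if_splits)
  then show ?thesis using t_eq s by simp
qed

section \<open>Subwords and the Demazure product\<close>

lemma represents_snoc:
  assumes "v \<in> lists S" "s \<in> S"
  shows "represents G S (v @ [s]) w \<longleftrightarrow>
    w \<in> carrier G \<and> len (w \<otimes> s) < len w \<and> represents G S v (w \<otimes> s)"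
proof
  assume *: "represents G S (v @ [s]) w"
  then have w: "w = wp v \<otimes> s" "len w = Suc (length v)"
    using assms by (auto simp: represents_def wp_snoc)
  then have "w \<otimes> s = wp v" using assms by simp
  moreover have "len (wp v) \<le> length v" using len_le assms by blast
  moreover have "len w \<le> Suc (len (wp v))" using len_mult_S_le[of "wp v" s] assms w by simp
  ultimately show "w \<in> carrier G \<and> len (w \<otimes> s) < len w \<and> represents G S v (w \<otimes> s)"
    using w assms by (auto simp: represents_def)
next
  assume *: "w \<in> carrier G \<and> len (w \<otimes> s) < len w \<and> represents G S v (w \<otimes> s)"
  then show "represents G S (v @ [s]) w"
    using assms len_mult_S_down[of w s] by (auto simp: represents_def wp_snoc)
qed

lemma subseq_lists: "\<lbrakk>subseq v P; P \<in> lists S\<rbrakk> \<Longrightarrow> v \<in> lists S"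
  by (metis in_lists_conv_set notin_set_nthsI subseq_conv_nths)

lemma contains_closed: "\<lbrakk>contains G S P w; P \<in> lists S\<rbrakk> \<Longrightarrow> w \<in> carrier G"
  using subseq_lists unfolding contains_def represents_def by blast

lemma contains_mono: "\<lbrakk>contains G S P w; subseq P P'\<rbrakk> \<Longrightarrow> contains G S P' w"
  unfolding contains_def using subseq_order.trans by blast

lemma contains_Nil_iff: "contains G S [] w \<longleftrightarrow> w = \<one>"
proof -
  have "len \<one> = 0" using len_le[of "[]"] by simp
  then show ?thesis by (auto simp: contains_def represents_def dest: list_emb_Nil2)
qed

lemma contains_len_le: "\<lbrakk>contains G S P w; P \<in> lists S\<rbrakk> \<Longrightarrow> len w \<le> length P"
  unfolding contains_def represents_def by (metis list_emb_length)

lemma contains_descent: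
  assumes "contains G S P w" "P \<in> lists S" "s \<in> S" "len (w \<otimes> s) < len w"
  shows "contains G S P (w \<otimes> s)"
proof -
  obtain v where v: "subseq v P" "wp v = w" "length v = len w"
    using assms by (auto simp: contains_def represents_def)
  then have vS: "v \<in> lists S" using assms subseq_lists by blast
  obtain i where i: "i < length v" "wp (delete_nth i v) = w \<otimes> s"
    using strong_exchange[OF vS reflection_S[OF assms(3)]] v assms by metis
  have "subseq (delete_nth i v) (take i v @ drop i v)"
    by (intro list_emb_append_mono) (auto simp: Cons_nth_drop_Suc[OF i(1), symmetric])
  then have "subseq (delete_nth i v) P" using v subseq_order.trans by auto
  moreover have "Suc (length (delete_nth i v)) = len w" using i v by auto
  moreover have "len w = Suc (len (w \<otimes> s))"
    using len_mult_S_down[of w s] assms contains_closed by auto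
  ultimately show ?thesis using i unfolding contains_def represents_def by auto
qed

text \<open>Containment is decided letter by letter from the right: a right descent of \<open>w\<close> is always absorbed by the last
  letter, even if \<open>P\<close> itself contains \<open>w\<close>, since then exchange removes the letter from \<open>w\<close>.\<close>

lemma contains_snoc:
  assumes P: "P \<in> lists S" and s: "s \<in> S" and w: "w \<in> carrier G"
  shows "contains G S (P @ [s]) w \<longleftrightarrow>
    contains G S P (if len (w \<otimes> s) < len w then w \<otimes> s else w)"
proof (cases "len (w \<otimes> s) < len w")
  case True
  have "contains G S (P @ [s]) w" if "contains G S P (w \<otimes> s)"
  proof -
    obtain v where v: "subseq v P" "represents G S v (w \<otimes> s)"
      using \<open>contains G S P (w \<otimes> s)\<close> by (auto simp: contains_def)
    then have "represents G S (v @ [s]) w"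
      using represents_snoc[of v s w] subseq_lists P s w True by blast
    then show ?thesis using v unfolding contains_def by (intro exI[of _ "v @ [s]"]) auto
  qed
  moreover have "contains G S P (w \<otimes> s)" if *: "contains G S (P @ [s]) w"
  proof -
    obtain v where v: "subseq v (P @ [s])" "represents G S v w"
      using * by (auto simp: contains_def)
    from v(1) consider "subseq v P" | u where "v = u @ [s]" "subseq u P"
      unfolding subseq_snoc_iff by blast
    then show ?thesis
    proof cases
      case 1
      then show ?thesis using v contains_descent[OF _ P s True] by (auto simp: contains_def)
    next
      case 2
      then show ?thesis
        using v represents_snoc[of u s w] subseq_lists[of u P] P s by (auto simp: contains_def)
    qed
  qed
  ultimately show ?thesis using True by auto
next
  case False
  have "contains G S P w" if *: "contains G S (P @ [s]) w"
  proof -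
    obtain v where v: "subseq v (P @ [s])" "represents G S v w"
      using * by (auto simp: contains_def)
    moreover have "v \<noteq> u @ [s]" if "subseq u P" for u
      using that v represents_snoc[of u s w] subseq_lists[of u P] P s False by auto
    ultimately show ?thesis using subseq_snoc_iff[of v P s] by (auto simp: contains_def)
  qed
  then show ?thesis using False contains_mono by (auto simp: contains_def)
qed

abbreviation dem :: "'a list \<Rightarrow> 'a" where "dem \<equiv> demazure G S"

lemma dem_Nil [simp]: "dem [] = \<one>"
  by (simp add: demazure_def)

lemma dem_snoc: "dem (P @ [s]) = (if len (dem P) < len (dem P \<otimes> s) then dem P \<otimes> s else dem P)"
  by (simp add: demazure_def demazure_step_def)

lemma dem_closed: "P \<in> lists S \<Longrightarrow> dem P \<in> carrier G"
  by (induction P rule: rev_induct) (auto simp: dem_snoc)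

text \<open>The step either creates the right descent \<open>s\<close> or is idle because \<open>s\<close> already is one.\<close>

lemma dem_snoc_descent:
  assumes "P \<in> lists S" "s \<in> S"
  shows "len (dem (P @ [s]) \<otimes> s) < len (dem (P @ [s]))"
  using len_mult_S_down[of "dem P" s] dem_closed assms by (auto simp: dem_snoc)

lemma dem_snoc_eq_iff:
  assumes "P \<in> lists S" "s \<in> S" "w \<in> carrier G"
  shows "dem (P @ [s]) = w \<longleftrightarrow> len (w \<otimes> s) < len w \<and> (dem P = w \<or> dem P = w \<otimes> s)"
proof (cases "len (w \<otimes> s) < len w")
  case True
  have d: "dem P \<in> carrier G" using assms dem_closed by blast
  have "dem P \<otimes> s = w \<longleftrightarrow> dem P = w \<otimes> s" using assms d by auto
  then show ?thesis using assms d True by (auto simp: dem_snoc)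
next
  case False
  then show ?thesis using assms dem_snoc_descent by auto
qed

lemma contains_dem: "P \<in> lists S \<Longrightarrow> contains G S P (dem P)"
proof (induction P rule: rev_induct)
  case (snoc s P)
  then have P: "P \<in> lists S" "s \<in> S" by auto
  then have "dem P \<in> carrier G" using dem_closed by blast
  then show ?case
    using snoc P contains_snoc[of P s "dem (P @ [s])"] dem_closed[of "P @ [s]"]
      dem_snoc_descent[of P s] contains_descent[of P "dem P" s]
    by (auto simp: dem_snoc split: if_splits)
qed (simp add: contains_Nil_iff)

text \<open>This replaces the chain property of the Bruhat order. If \<open>w s\<close> is longer than \<open>w\<close>, appending \<open>s\<close> to a word of \<open>w\<close>
  suffices. Otherwise \<open>P\<close> contains \<open>w s\<close>, and induction gives a subword \<open>T\<close> of length \<open>len w\<close> that contains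
  \<open>w s\<close>. If \<open>T @ [s]\<close> is reduced, it works. If not, \<open>lifting_cover\<close> shows that \<open>T\<close> is a word for
  \<open>w\<close>, and the induction hypothesis applies to \<open>P\<close> and \<open>w\<close> itself.\<close>

lemma contains_cover:
  assumes "P \<in> lists S" "contains G S P w" "dem P \<noteq> w"
  shows "\<exists>T. subseq T P \<and> represents G S T (wp T) \<and> length T = Suc (len w) \<and> contains G S T w"
  using assms
proof (induction P arbitrary: w rule: rev_induct)
  case Nil
  then show ?case by (simp add: contains_Nil_iff)
next
  case (snoc s P)
  then have P: "P \<in> lists S" and s: "s \<in> S" by auto
  have w: "w \<in> carrier G" using snoc contains_closed by blast
  show ?case
  proof (cases "len (w \<otimes> s) < len w")
    case False
    have "contains G S P w" using snoc.prems contains_snoc[OF P s w] False by simp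
    then obtain v where v: "subseq v P" "represents G S v w" by (auto simp: contains_def)
    have vS: "v \<in> lists S" using v P subseq_lists by blast
    have up: "len (w \<otimes> s) = Suc (len w)"
      by (rule len_mult_S_cases[OF w s]) (use False in auto)
    have "represents G S (v @ [s]) (wp (v @ [s]))"
      using v vS s up by (auto simp: represents_def wp_snoc)
    moreover have "contains G S (v @ [s]) w" using v by (auto simp: contains_def)
    moreover have "length (v @ [s]) = Suc (len w)" using v by (simp add: represents_def)
    ultimately show ?thesis using v by (intro exI[of _ "v @ [s]"]) auto
  next
    case True
    have ws: "w \<otimes> s \<in> carrier G" "len w = Suc (len (w \<otimes> s))"
      using w s len_mult_S_down True by auto
    have c: "contains G S P (w \<otimes> s)" using snoc.prems contains_snoc[OF P s w] True by simp
    have ne: "dem P \<noteq> w" "dem P \<noteq> w \<otimes> s"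
      using snoc.prems dem_snoc_eq_iff[OF P s w] True by auto
    obtain T where T: "subseq T P" "represents G S T (wp T)" "length T = Suc (len (w \<otimes> s))"
        "contains G S T (w \<otimes> s)"
      using snoc.IH[OF P c] ne by metis
    have TS: "T \<in> lists S" using T P subseq_lists by blast
    show ?thesis
    proof (cases "len (wp T \<otimes> s) < len (wp T)")
      case False
      then have "len (wp T \<otimes> s) = Suc (len (wp T))"
        using len_mult_S_cases[of "wp T" s] TS s by (metis lessI wp_closed)
      then have "represents G S (T @ [s]) (wp (T @ [s]))"
        using T TS s by (auto simp: represents_def wp_snoc)
      moreover have "contains G S (T @ [s]) w" using contains_snoc[OF TS s w] True T by simp
      ultimately show ?thesis using T ws by (intro exI[of _ "T @ [s]"]) auto
    next
      case down: True
      obtain u where u: "subseq u T" "represents G S u (w \<otimes> s)" using T by (auto simp: contains_def)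
      have "wp T = w"
      proof -
        obtain y b z where yz: "T = y @ b # z" "u = y @ z"
          using subseq_one_shorter[OF u(1)] u(2) T(3) by (auto simp: represents_def)
        define t where "t = inv wp z \<otimes> b \<otimes> inv (inv wp z)"
        have S: "y \<in> lists S" "b \<in> S" "z \<in> lists S" using TS yz by auto
        have t: "reflection t" unfolding t_def
          using reflection_conj[OF reflection_S, of b "inv wp z"] S by simp
        have wpT: "wp T = (w \<otimes> s) \<otimes> t"
        proof -
          have "w \<otimes> s = wp y \<otimes> wp z"
            using u(2) S yz by (simp add: represents_def wp_append)
          then show ?thesis using S yz by (simp add: t_def wp_append m_assoc)
        qed
        have "t = s"
        proof (rule lifting_cover[OF ws(1) t s])
          show "len (w \<otimes> s \<otimes> t) = Suc (len (w \<otimes> s))"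
            using T wpT by (simp add: represents_def)
          show "len (w \<otimes> s) < len (w \<otimes> s \<otimes> s)" using True w s by simp
          show "len (w \<otimes> s \<otimes> t \<otimes> s) < len (w \<otimes> s \<otimes> t)" using down wpT by simp
        qed
        then show ?thesis using wpT w s by simp
      qed
      then have "contains G S P w" using T by (auto simp: contains_def)
      then obtain T' where "subseq T' P" "represents G S T' (wp T')" "length T' = Suc (len w)"
        "contains G S T' w" using snoc.IH[OF P] ne by blast
      then show ?thesis by (intro exI[of _ T']) auto
    qed
  qed
qed

text \<open>By \<open>contains_cover\<close> one climbs in steps of length one through elements contained in \<open>P\<close>, and the climb
  can only end at the Demazure product.\<close>

lemma contains_maximal:
  assumes "P \<in> lists S" "contains G S P w"
  shows "len w < len (dem P) \<or> w = dem P"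
  using assms(2)
proof (induction "length P - len w" arbitrary: w rule: less_induct)
  case less
  show ?case
  proof (cases "w = dem P")
    case False
    then obtain T where T: "subseq T P" "represents G S T (wp T)" "length T = Suc (len w)"
      using contains_cover[OF assms(1) less.prems] by blast
    then have c: "contains G S P (wp T)" by (auto simp: contains_def)
    have l: "len (wp T) = Suc (len w)" using T by (auto simp: represents_def)
    then have "length P - len (wp T) < length P - len w"
      using contains_len_le[OF c assms(1)] by simp
    then show ?thesis using less.hyps c l by fastforce
  qed simp
qed

text \<open>For \<open>P\<close> between a word containing \<open>w s\<close> and the word \<open>P'\<close>, the length of \<open>dem P\<close> is squeezed between the
  consecutive numbers \<open>len (w s)\<close> and \<open>len w\<close>, and maximality determines \<open>dem P\<close> in either case.\<close>

lemma dem_sandwich: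
  assumes P: "P \<in> lists S" "P' \<in> lists S" and sub: "subseq P P'"
    and w: "w \<in> carrier G" "s \<in> S" "len (w \<otimes> s) < len w" and c: "contains G S P (w \<otimes> s)"
    and d: "dem P' = w \<or> dem P' = w \<otimes> s"
  shows "dem P = w \<or> dem P = w \<otimes> s"
proof -
  have l: "len w = Suc (len (w \<otimes> s))" using w len_mult_S_down by simp
  have "contains G S P' (dem P)" using contains_dem[OF P(1)] sub contains_mono by blast
  then have "len (dem P) < len (dem P') \<or> dem P = dem P'" using contains_maximal P by blast
  then show ?thesis
  proof
    assume "len (dem P) < len (dem P')"
    moreover have "len (dem P') \<le> Suc (len (w \<otimes> s))" using d l by (elim disjE) simp_all
    ultimately have "\<not> len (w \<otimes> s) < len (dem P)" by linarith
    then show ?thesis using contains_maximal[OF P(1) c] by simp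
  next
    assume "dem P = dem P'"
    then show ?thesis using d by simp
  qed
qed

section \<open>Deleting one letter\<close>

text \<open>Two letters with the same reflection could both be deleted without changing the product.\<close>

lemma refl_count_le_1:
  assumes "v \<in> lists S" "len (wp v) = length v" "reflection t"
  shows "refl_count v t \<le> 1"
  using assms(1,2)
proof (induction v)
  case (Cons s v)
  have S: "s \<in> S" "v \<in> lists S" using Cons by auto
  have red: "len (wp v) = length v"
  proof -
    obtain u where u: "u \<in> lists S" "wp u = wp v" "length u = len (wp v)"
      using reduced_word_exists[OF wp_closed[OF S(2)]] by blast
    have "len (wp (s # u)) \<le> length (s # u)" by (rule len_le) (use u S in auto)
    then have "length v \<le> len (wp v)" using u Cons.prems by simp
    then show ?thesis using len_le[OF S(2)] by simp
  qed
  then have IH: "refl_count v t \<le> 1" using Cons.IH S by blast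
  \<comment> \<open>If the first letter also gave \<open>t\<close>, deleting it would have the same effect as multiplying by \<open>t\<close>.\<close>
  have "even (refl_count v t)" if "s \<otimes> wp v = wp v \<otimes> t"
  proof -
    have "len (wp v \<otimes> t) = length (s # v)" using that Cons.prems by simp
    then show ?thesis using shorter_iff_odd_refl_count[OF S(2) assms(3)] red by simp
  qed
  then show ?case using IH by (cases "refl_count v t") auto
qed simp

text \<open>All letters whose deletion gives \<open>w\<close> share the reflection \<open>t\<close> with \<open>wp v \<otimes> t = w\<close>. Their number is odd
  exactly if \<open>w\<close> is shorter than \<open>wp v\<close>, which by the length of \<open>v\<close> means that \<open>v\<close> is reduced; and then
  the number is at most 1.\<close>

lemma delete_unique_iff_reduced:
  assumes v: "v \<in> lists S" and l: "length v = Suc (len w)" and c: "contains G S v w"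
  shows "(\<exists>!i. i < length v \<and> wp (delete_nth i v) = w) \<longleftrightarrow> len (wp v) = length v"
proof -
  have w: "w \<in> carrier G" using c v contains_closed by blast
  obtain u where u: "subseq u v" "represents G S u w" using c by (auto simp: contains_def)
  then obtain y b z where yz: "v = y @ b # z" "u = y @ z"
    using subseq_one_shorter[OF u(1)] l by (auto simp: represents_def)
  have S: "y \<in> lists S" "b \<in> S" "z \<in> lists S" using v yz by auto
  \<comment> \<open>The double inverse is the form in which \<open>reflection_conj\<close> produces the conjugate.\<close>
  define t where "t = inv wp z \<otimes> b \<otimes> inv (inv wp z)"
  have t: "reflection t" unfolding t_def
    using reflection_conj[OF reflection_S, of b "inv wp z"] S by simp
  have wt: "wp v \<otimes> t = w"
    using u S yz by (simp add: t_def represents_def wp_append m_assoc)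
  let ?A = "{i. i < length v \<and> wp (delete_nth i v) = w}"
  have card: "refl_count v t = card ?A"
    using refl_count_eq_card[OF v reflection_closed[OF t]] wt by simp
  have "length y \<in> ?A" using yz u by (auto simp: represents_def)
  then have pos: "refl_count v t \<noteq> 0" unfolding card by (subst card_0_eq) auto
  have "(\<exists>!i. i \<in> ?A) \<longleftrightarrow> refl_count v t = 1"
    unfolding card card_eq_1_iff_ex1 by simp
  also have "\<dots> \<longleftrightarrow> len (wp v) = length v"
  proof
    assume "refl_count v t = 1"
    then have "len w < len (wp v)" using shorter_iff_odd_refl_count[OF v t] wt by simp
    then show "len (wp v) = length v" using len_le[OF v] l by simp
  next
    assume "len (wp v) = length v"
    then show "refl_count v t = 1" using refl_count_le_1[OF v _ t] pos by simp
  qed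
  finally show ?thesis by simp
qed

end

section \<open>Cones over simplicial complexes\<close>

text \<open>The infinite cone over the geometric realization of \<open>K\<close>.\<close>

definition face_cone :: "'v set set \<Rightarrow> ('v \<Rightarrow> real) set" where
  "face_cone K = {x. (\<forall>v. 0 \<le> x v) \<and> {v. x v \<noteq> 0} \<in> K}"

definition complex_on :: "'v set \<Rightarrow> 'v set set \<Rightarrow> bool" where
  "complex_on V K \<longleftrightarrow> K \<subseteq> Pow V \<and> (\<forall>F\<in>K. \<forall>F'\<subseteq>F. F' \<in> K)"

definition scale :: "real \<Rightarrow> ('v \<Rightarrow> real) \<Rightarrow> 'v \<Rightarrow> real" where
  "scale c x = (\<lambda>v. c * x v)"

definition coord_space :: "nat \<Rightarrow> (nat \<Rightarrow> real) set" where
  "coord_space n = {y. \<forall>i\<ge>n. y i = 0}"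

definition half_space :: "nat \<Rightarrow> (nat \<Rightarrow> real) set" where
  "half_space n = {y \<in> coord_space (Suc n). 0 \<le> y n}"

text \<open>Compatibility with positive scalings means that rays are mapped to rays, so that such a homeomorphism of cones
  descends to their sections.\<close>

definition conic_homeo ::
    "('v \<Rightarrow> real) set \<Rightarrow> ('w \<Rightarrow> real) set \<Rightarrow> (('v \<Rightarrow> real) \<Rightarrow> 'w \<Rightarrow> real) \<Rightarrow> (('w \<Rightarrow> real) \<Rightarrow> 'v \<Rightarrow> real) \<Rightarrow> bool" where
  "conic_homeo X Y h h' \<longleftrightarrow> homeomorphism X Y h h' \<and> (\<forall>x\<in>X. \<forall>c>0. h (scale c x) = scale c (h x))"

definition sphere_like :: "'v set set \<Rightarrow> nat \<Rightarrow> bool" where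
  "sphere_like K n \<longleftrightarrow> (\<exists>h h'. conic_homeo (face_cone K) (coord_space n) h h')"

text \<open>The complex \<open>B\<close> is the boundary of the ball. Recording it, and recording that the given homeomorphism
  takes it to the bounding hyperplane, is what allows the induction to attach cones along parts
  of the boundary.\<close>

definition ball_like :: "'v set set \<Rightarrow> 'v set set \<Rightarrow> nat \<Rightarrow> bool" where
  "ball_like K B n \<longleftrightarrow> (\<exists>h h'. conic_homeo (face_cone K) (half_space n) h h' \<and>
     (\<forall>x\<in>face_cone K. h x n = 0 \<longleftrightarrow> x \<in> face_cone B))"

definition cone_complex :: "'v \<Rightarrow> 'v set set \<Rightarrow> 'v set set" where
  "cone_complex a L = L \<union> insert a ` L"

lemma scale_apply [simp]: "scale c x v = c * x v"
  by (simp add: scale_def)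

lemma scale_fun_upd_0: "(scale c x)(v := 0) = scale c (x(v := 0))"
  by (auto simp: scale_def)

lemma scale_scale [simp]: "scale c (scale d x) = scale (c * d) x"
  by (auto simp: scale_def)

lemma scale_1 [simp]: "scale 1 x = x"
  by (auto simp: scale_def)

lemma scale_in_face_cone_iff: "c > 0 \<Longrightarrow> scale c x \<in> face_cone K \<longleftrightarrow> x \<in> face_cone K"
  by (simp add: face_cone_def zero_le_mult_iff)

lemma scale_in_coord_space: "y \<in> coord_space n \<Longrightarrow> scale c y \<in> coord_space n"
  by (simp add: coord_space_def)

lemma scale_in_half_space: "\<lbrakk>c > 0; y \<in> half_space n\<rbrakk> \<Longrightarrow> scale c y \<in> half_space n"
  by (simp add: half_space_def scale_in_coord_space)

lemma half_space_upd: "\<lbrakk>y \<in> half_space n; 0 \<le> a\<rbrakk> \<Longrightarrow> y(n := a) \<in> half_space n"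
  by (auto simp: half_space_def coord_space_def)

lemma half_space_0_iff: "y n = 0 \<Longrightarrow> y \<in> half_space n \<longleftrightarrow> y \<in> coord_space n"
  by (auto simp: half_space_def coord_space_def le_Suc_eq dest: antisym) (metis Suc_leI le_neq_implies_less)

lemma coord_space_upd: "y \<in> coord_space n \<Longrightarrow> y(n := a) \<in> coord_space (Suc n)"
  by (auto simp: coord_space_def)

lemma conic_homeoI:
  assumes "continuous_on X h" "continuous_on Y h'"
    and "\<And>x. x \<in> X \<Longrightarrow> h x \<in> Y \<and> h' (h x) = x"
    and "\<And>y. y \<in> Y \<Longrightarrow> h' y \<in> X \<and> h (h' y) = y"
    and "\<And>x c. \<lbrakk>x \<in> X; c > 0\<rbrakk> \<Longrightarrow> h (scale c x) = scale c (h x)"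
  shows "conic_homeo X Y h h'"
  unfolding conic_homeo_def by (intro conjI homeomorphismI) (use assms in auto)

lemma conic_homeoD:
  assumes "conic_homeo X Y h h'"
  shows "continuous_on X h" "continuous_on Y h'"
    and "x \<in> X \<Longrightarrow> h x \<in> Y" "x \<in> X \<Longrightarrow> h' (h x) = x"
    and "y \<in> Y \<Longrightarrow> h' y \<in> X" "y \<in> Y \<Longrightarrow> h (h' y) = y"
    and "\<lbrakk>x \<in> X; c > 0\<rbrakk> \<Longrightarrow> h (scale c x) = scale c (h x)"
  using assms unfolding conic_homeo_def homeomorphism_def by auto

lemma conic_homeo_inverse_scale:
  assumes "conic_homeo X Y h h'" "y \<in> Y" "c > 0" "\<And>x. x \<in> X \<Longrightarrow> scale c x \<in> X"
  shows "h' (scale c y) = scale c (h' y)"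
proof -
  note h = conic_homeoD[OF assms(1)]
  have "h (scale c (h' y)) = scale c y" using h assms by simp
  then show ?thesis using h assms by metis
qed

lemma continuous_on_fun_upd:
  assumes "continuous_on X f" "continuous_on X a"
  shows "continuous_on X (\<lambda>x. (f x)(i := a x))"
proof (rule continuous_on_coordinatewise_then_product)
  fix j
  show "continuous_on X (\<lambda>x. ((f x)(i := a x)) j)"
    using assms continuous_on_product_then_coordinatewise[OF assms(1)] by (cases "j = i") auto
qed

lemma continuous_on_coordinate: "continuous_on X (\<lambda>x. x i)"
  by (rule continuous_on_subset[OF continuous_on_product_coordinates]) auto

text \<open>The pieces of the piecewise formulas below are cones over subcomplexes; closedness is what makes
  such a formula continuous.\<close>

lemma closed_face_cone:
  assumes "finite V" "complex_on V K"
  shows "closed (face_cone K)"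
proof -
  have eq: "face_cone K = (\<Union>F\<in>K. {x. \<forall>v. 0 \<le> x v \<and> (v \<notin> F \<longrightarrow> x v = 0)})" (is "_ = ?R")
  proof
    show "face_cone K \<subseteq> ?R" by (auto simp: face_cone_def)
    show "?R \<subseteq> face_cone K"
    proof
      fix x assume "x \<in> ?R"
      then obtain F where F: "F \<in> K" "\<forall>v. 0 \<le> x v \<and> (v \<notin> F \<longrightarrow> x v = 0)" by auto
      then have "{v. x v \<noteq> 0} \<subseteq> F" by auto
      then show "x \<in> face_cone K" using F assms by (auto simp: face_cone_def complex_on_def)
    qed
  qed
  have "finite K" using assms by (meson complex_on_def finite_Pow_iff finite_subset)
  moreover have "closed {x :: 'a \<Rightarrow> real. \<forall>v. 0 \<le> x v \<and> (v \<notin> F \<longrightarrow> x v = 0)}" for F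
  proof (intro closed_Collect_all closed_Collect_conj closed_Collect_imp)
    show "closed {x :: 'a \<Rightarrow> real. 0 \<le> x v}" for v
      by (intro closed_Collect_le) auto
    show "closed {x :: 'a \<Rightarrow> real. x v = 0}" for v
      by (intro closed_Collect_eq) auto
  qed auto
  ultimately show ?thesis unfolding eq by (intro closed_UN) auto
qed

lemma face_cone_mono: "K \<subseteq> K' \<Longrightarrow> face_cone K \<subseteq> face_cone K'"
  by (auto simp: face_cone_def)

lemma face_cone_Un: "face_cone (K \<union> K') = face_cone K \<union> face_cone K'"
  by (auto simp: face_cone_def)

lemma face_cone_Int: "face_cone (K \<inter> K') = face_cone K \<inter> face_cone K'"
  by (auto simp: face_cone_def)

lemma face_cone_outside: "\<lbrakk>x \<in> face_cone K; complex_on V K; v \<notin> V\<rbrakk> \<Longrightarrow> x v = 0"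
  by (auto simp: face_cone_def complex_on_def)

lemma support_upd_0: "{v. (x(a := 0)) v \<noteq> (0::real)} = {v. x v \<noteq> 0} - {a}"
  by auto

lemma complex_on_cone: "complex_on V L \<Longrightarrow> complex_on (insert a V) (cone_complex a L)"
  unfolding complex_on_def
proof (intro conjI ballI allI impI)
  fix F F' assume L: "L \<subseteq> Pow V \<and> (\<forall>F\<in>L. \<forall>F'\<subseteq>F. F' \<in> L)" and F: "F \<in> cone_complex a L" "F' \<subseteq> F"
  then obtain E where E: "E \<in> L" "F \<subseteq> insert a E" by (auto simp: cone_complex_def)
  then have "F' - {a} \<subseteq> E" using F by blast
  then have "F' - {a} \<in> L" using L E by blast
  then show "F' \<in> cone_complex a L"
  proof (cases "a \<in> F'")
    case True
    then have "F' = insert a (F' - {a})" by auto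
    then show ?thesis using \<open>F' - {a} \<in> L\<close> unfolding cone_complex_def by blast
  next
    case False
    then have "F' = F' - {a}" by auto
    then show ?thesis using \<open>F' - {a} \<in> L\<close> unfolding cone_complex_def by simp
  qed
qed (auto simp: cone_complex_def)

lemma cone_complex_iff:
  assumes "complex_on V L" "a \<notin> V"
  shows "F \<in> cone_complex a L \<longleftrightarrow> F - {a} \<in> L"
proof
  assume "F \<in> cone_complex a L"
  then show "F - {a} \<in> L" using assms by (auto simp: cone_complex_def complex_on_def)
next
  assume *: "F - {a} \<in> L"
  show "F \<in> cone_complex a L"
  proof (cases "a \<in> F")
    case True
    then have "F = insert a (F - {a})" by auto
    then show ?thesis using * unfolding cone_complex_def by blast
  qed (use * in \<open>auto simp: cone_complex_def\<close>)
qed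

lemma face_cone_cone_iff:
  assumes "complex_on V L" "a \<notin> V"
  shows "x \<in> face_cone (cone_complex a L) \<longleftrightarrow> 0 \<le> x a \<and> x(a := 0) \<in> face_cone L"
  unfolding face_cone_def mem_Collect_eq cone_complex_iff[OF assms] support_upd_0 by auto

lemma sphere_like_point: "sphere_like {{}} 0"
proof -
  have "face_cone {{}} = {\<lambda>_. 0 :: real}" "coord_space 0 = {\<lambda>_. 0}"
    by (auto simp: face_cone_def coord_space_def)
  then have "conic_homeo (face_cone {{}}) (coord_space 0) (\<lambda>_ _. 0) (\<lambda>_ _. 0)"
    by (intro conic_homeoI) (auto simp: scale_def)
  then show ?thesis unfolding sphere_like_def by blast
qed

text \<open>The new coordinate is appended as the last coordinate of the half space.\<close>

lemma cone_sphere: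
  assumes L: "complex_on V L" "a \<notin> V" and s: "sphere_like L n"
  shows "ball_like (cone_complex a L) L n"
proof -
  obtain h h' where hh: "conic_homeo (face_cone L) (coord_space n) h h'"
    using s sphere_like_def by blast
  note h = conic_homeoD[OF hh]
  note K = face_cone_cone_iff[OF L]
  define H where "H x = (h (x(a := 0)))(n := x a)" for x
  define H' where "H' y = (h' (y(n := 0)))(a := y n)" for y
  have La: "x a = 0" if "x \<in> face_cone L" for x using face_cone_outside that L by metis
  have half: "y(n := 0) \<in> coord_space n" if "y \<in> half_space n" for y
    using that half_space_upd[of y n 0] half_space_0_iff[of "y(n := 0)" n] by simp
  have "conic_homeo (face_cone (cone_complex a L)) (half_space n) H H'"
  proof (rule conic_homeoI)
    show "continuous_on (face_cone (cone_complex a L)) H" unfolding H_def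
      by (intro continuous_on_fun_upd continuous_on_compose2[OF h(1)] continuous_on_id
           continuous_on_const continuous_on_coordinate) (auto simp: K)
    show "continuous_on (half_space n) H'" unfolding H'_def
      by (intro continuous_on_fun_upd continuous_on_compose2[OF h(2)] continuous_on_id
           continuous_on_const continuous_on_coordinate) (auto simp: half)
    show "H x \<in> half_space n \<and> H' (H x) = x" if "x \<in> face_cone (cone_complex a L)" for x
    proof -
      have x: "0 \<le> x a" "x(a := 0) \<in> face_cone L" using that K by auto
      have c: "h (x(a := 0)) \<in> coord_space n" using h x by blast
      have "(h (x(a := 0)))(n := 0) = h (x(a := 0))" using c by (auto simp: coord_space_def)
      then show ?thesis using x h coord_space_upd[OF c] by (auto simp: H_def H'_def half_space_def)
    qed
    show "H' y \<in> face_cone (cone_complex a L) \<and> H (H' y) = y" if "y \<in> half_space n" for y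
    proof -
      have y: "y(n := 0) \<in> coord_space n" "0 \<le> y n" using half that by (auto simp: half_space_def)
      then have "h' (y(n := 0)) \<in> face_cone L" using h by blast
      moreover from this have "(h' (y(n := 0)))(a := 0) = h' (y(n := 0))" using La by auto
      ultimately show ?thesis using y h by (auto simp: H_def H'_def K)
    qed
    show "H (scale c x) = scale c (H x)" if "x \<in> face_cone (cone_complex a L)" "c > 0" for x c
    proof -
      have "h (scale c (x(a := 0))) = scale c (h (x(a := 0)))" using h(7) that K by blast
      then show ?thesis unfolding H_def scale_fun_upd_0 by (auto simp: fun_eq_iff)
    qed
  qed
  moreover have "H x n = 0 \<longleftrightarrow> x \<in> face_cone L" if "x \<in> face_cone (cone_complex a L)" for x
  proof -
    have "x(a := 0) = x" if "x a = 0" using that by auto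
    then show ?thesis using that La by (auto simp: H_def K)
  qed
  ultimately show ?thesis unfolding ball_like_def by blast
qed

text \<open>The pair formed by the height \<open>u n\<close> of the old half space and the new coordinate lies in a quadrant. The
  map \<open>(p, q) \<mapsto> (p - q, min p q)\<close> opens the quadrant to a half plane and takes its two edges to the
  bounding line; its inverse is \<open>(d, r) \<mapsto> (r + max d 0, r + max (- d) 0)\<close>.\<close>

lemma cone_ball:
  assumes L: "complex_on V L" "a \<notin> V" and b: "ball_like L B n" and B: "complex_on V B" "B \<subseteq> L"
  shows "ball_like (cone_complex a L) (L \<union> cone_complex a B) (Suc n)"
proof -
  obtain h h' where hh: "conic_homeo (face_cone L) (half_space n) h h'"
    and bd: "\<And>x. x \<in> face_cone L \<Longrightarrow> h x n = 0 \<longleftrightarrow> x \<in> face_cone B"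
    using b ball_like_def by blast
  note h = conic_homeoD[OF hh]
  note K = face_cone_cone_iff[OF L]
  define H where "H x = (let u = h (x(a := 0)) in u(n := u n - x a, Suc n := min (u n) (x a)))" for x
  define H' where "H' y = (h' (y(n := y (Suc n) + max (y n) 0, Suc n := 0)))
      (a := y (Suc n) + max (- y n) 0)" for y
  have La: "x a = 0" if "x \<in> face_cone L" for x using face_cone_outside that L by metis
  have half: "y(n := y (Suc n) + max (y n) 0, Suc n := 0) \<in> half_space n" if "y \<in> half_space (Suc n)" for y
    using that by (auto simp: half_space_def coord_space_def not_less_eq_eq)
  have "conic_homeo (face_cone (cone_complex a L)) (half_space (Suc n)) H H'"
  proof (rule conic_homeoI)
    have u: "continuous_on (face_cone (cone_complex a L)) (\<lambda>x. h (x(a := 0)))"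
      by (intro continuous_on_compose2[OF h(1)] continuous_on_fun_upd continuous_on_id
          continuous_on_const) (auto simp: K)
    show "continuous_on (face_cone (cone_complex a L)) H" unfolding H_def Let_def
      by (intro continuous_on_diff continuous_on_min continuous_on_fun_upd u
           continuous_on_product_then_coordinatewise[OF u] continuous_on_coordinate)
    show "continuous_on (half_space (Suc n)) H'" unfolding H'_def
      by (intro continuous_on_fun_upd continuous_on_compose2[OF h(2)] continuous_on_id
           continuous_on_const continuous_on_coordinate continuous_on_add continuous_on_max continuous_on_minus) (auto simp: half)
    show "H x \<in> half_space (Suc n) \<and> H' (H x) = x" if "x \<in> face_cone (cone_complex a L)" for x
    proof -
      have x: "0 \<le> x a" "x(a := 0) \<in> face_cone L" using that K by auto
      have c: "h (x(a := 0)) \<in> half_space n" using h x by blast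
      define u where "u = h (x(a := 0))"
      have u: "u \<in> coord_space (Suc n)" "0 \<le> u n" "h' u = x(a := 0)"
        using c h x by (auto simp: u_def half_space_def)
      have "min (u n) (x a) + max (u n - x a) 0 = u n" "min (u n) (x a) + max (x a - u n) 0 = x a"
        by auto
      moreover have "u(n := u n, Suc n := 0) = u" using u by (auto simp: coord_space_def)
      ultimately have "H' (H x) = x" using u by (simp add: H_def H'_def flip: u_def)
      moreover have "H x \<in> half_space (Suc n)"
        using u x by (auto simp: H_def half_space_def coord_space_def simp flip: u_def)
      ultimately show ?thesis by blast
    qed
    show "H' y \<in> face_cone (cone_complex a L) \<and> H (H' y) = y" if "y \<in> half_space (Suc n)" for y
    proof -
      define w where "w = y(n := y (Suc n) + max (y n) 0, Suc n := 0)"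
      have w: "h' w \<in> face_cone L" "h (h' w) = w" using half[OF that] h by (auto simp: w_def)
      have "(h' w)(a := 0) = h' w" using La w by auto
      then have "H' y \<in> face_cone (cone_complex a L)" "H (H' y) = y"
        using w that by (auto simp: H_def H'_def K Let_def half_space_def simp flip: w_def)
          (auto simp: w_def max_def)
      then show ?thesis by blast
    qed
    show "H (scale c x) = scale c (H x)" if "x \<in> face_cone (cone_complex a L)" "c > 0" for x c
    proof -
      have "h (scale c (x(a := 0))) = scale c (h (x(a := 0)))" using h(7) that K by blast
      then show ?thesis unfolding H_def Let_def scale_fun_upd_0 using that(2)
        by (auto simp: fun_eq_iff min_def right_diff_distrib)
    qed
  qed
  moreover have "H x (Suc n) = 0 \<longleftrightarrow> x \<in> face_cone (L \<union> cone_complex a B)" if "x \<in> face_cone (cone_complex a L)" for x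
  proof -
    have x: "0 \<le> x a" "x(a := 0) \<in> face_cone L" using that K by auto
    then have "0 \<le> h (x(a := 0)) n" using h by (auto simp: half_space_def)
    then have "H x (Suc n) = 0 \<longleftrightarrow> x a = 0 \<or> h (x(a := 0)) n = 0"
      using x by (auto simp: H_def Let_def min_def)
    moreover have "x a = 0 \<longleftrightarrow> x \<in> face_cone L"
    proof
      assume "x a = 0"
      then have "x(a := 0) = x" by auto
      then show "x \<in> face_cone L" using x by simp
    qed (use La in auto)
    ultimately show ?thesis
      using bd[OF x(2)] face_cone_cone_iff[OF B(1) L(2)] x by (auto simp: face_cone_Un)
  qed
  ultimately show ?thesis unfolding ball_like_def by blast
qed

text \<open>The new coordinate is positive only over the bounding hyperplane, where it continues the height to
  negative values.\<close>

lemma ball_Un_cone_boundary: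
  assumes D: "complex_on V D" and L: "complex_on V L" "L \<subseteq> D" and a: "a \<notin> V" and b: "ball_like D L n"
  shows "sphere_like (D \<union> cone_complex a L) (Suc n)"
proof -
  obtain h h' where hh: "conic_homeo (face_cone D) (half_space n) h h'"
    and bd: "\<And>x. x \<in> face_cone D \<Longrightarrow> h x n = 0 \<longleftrightarrow> x \<in> face_cone L"
    using b ball_like_def by blast
  note h = conic_homeoD[OF hh]
  note LD = face_cone_mono[OF L(2)]
  let ?K = "D \<union> cone_complex a L"
  define H where "H x = (let u = h (x(a := 0)) in u(n := u n - x a))" for x
  define H' where "H' y = (h' (y(n := max (y n) 0)))(a := max (- y n) 0)" for y
  have Da: "x a = 0" "x(a := 0) = x" if "x \<in> face_cone D" for x
    using face_cone_outside[OF that D a] by auto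
  have K: "x \<in> face_cone ?K \<longleftrightarrow> 0 \<le> x a \<and> x(a := 0) \<in> face_cone D \<and> (x a = 0 \<or> x(a := 0) \<in> face_cone L)" for x
  proof -
    have "x(a := 0) = x" if "x a = 0" using that by auto
    then show ?thesis
      using face_cone_cone_iff[OF L(1) a, of x] LD Da[of x] by (auto simp: face_cone_Un)
  qed
  have half: "y(n := max (y n) 0) \<in> half_space n" if "y \<in> coord_space (Suc n)" for y
    using that by (auto simp: half_space_def coord_space_def)
  have "conic_homeo (face_cone ?K) (coord_space (Suc n)) H H'"
  proof (rule conic_homeoI)
    have u: "continuous_on (face_cone ?K) (\<lambda>x. h (x(a := 0)))"
      by (intro continuous_on_compose2[OF h(1)] continuous_on_fun_upd continuous_on_id
          continuous_on_const) (auto simp: K)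
    show "continuous_on (face_cone ?K) H" unfolding H_def Let_def
      by (intro continuous_on_diff continuous_on_min continuous_on_fun_upd u
           continuous_on_product_then_coordinatewise[OF u] continuous_on_coordinate)
    show "continuous_on (coord_space (Suc n)) H'" unfolding H'_def
      by (intro continuous_on_fun_upd continuous_on_compose2[OF h(2)] continuous_on_id
           continuous_on_const continuous_on_coordinate continuous_on_add continuous_on_max continuous_on_minus) (auto simp: half)
    show "H x \<in> coord_space (Suc n) \<and> H' (H x) = x" if "x \<in> face_cone ?K" for x
    proof -
      have x: "0 \<le> x a" "x(a := 0) \<in> face_cone D" "x a = 0 \<or> x(a := 0) \<in> face_cone L"
        using that K by auto
      define u where "u = h (x(a := 0))"
      have u: "u \<in> coord_space (Suc n)" "0 \<le> u n" "h' u = x(a := 0)" "x a = 0 \<or> u n = 0"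
        using h x bd by (auto simp: u_def half_space_def)
      have "max (u n - x a) 0 = u n" "max (x a - u n) 0 = x a" using u x by auto
      then have "H' (H x) = x" using u by (simp add: H_def H'_def flip: u_def)
      moreover have "H x \<in> coord_space (Suc n)"
        using u by (auto simp: H_def coord_space_def simp flip: u_def)
      ultimately show ?thesis by blast
    qed
    show "H' y \<in> face_cone ?K \<and> H (H' y) = y" if "y \<in> coord_space (Suc n)" for y
    proof -
      define w where "w = y(n := max (y n) 0)"
      have w: "h' w \<in> face_cone D" "h (h' w) = w" using half[OF that] h by (auto simp: w_def)
      have "h' w \<in> face_cone L" if "y n < 0" using bd[OF w(1)] w that by (simp add: w_def)
      then have "H' y \<in> face_cone ?K" "H (H' y) = y"
        using w Da[OF w(1)] by (auto simp: H_def H'_def K Let_def max_def simp flip: w_def)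
          (auto simp: w_def max_def)
      then show ?thesis by blast
    qed
    show "H (scale c x) = scale c (H x)" if "x \<in> face_cone ?K" "c > 0" for x c
    proof -
      have "h (scale c (x(a := 0))) = scale c (h (x(a := 0)))" using h(7) that K by blast
      then show ?thesis unfolding H_def Let_def scale_fun_upd_0
        by (auto simp: fun_eq_iff right_diff_distrib)
    qed
  qed
  then show ?thesis unfolding sphere_like_def by blast
qed

section \<open>Attaching a cone along a ball in the boundary\<close>

lemma closed_half_space: "closed (half_space n)"
proof -
  have "closed {y :: nat \<Rightarrow> real. (\<forall>i. Suc n \<le> i \<longrightarrow> y i = 0) \<and> 0 \<le> y n}"
    by (intro closed_Collect_conj closed_Collect_all closed_Collect_imp closed_Collect_eq
        closed_Collect_le) auto
  then show ?thesis by (simp add: half_space_def coord_space_def)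
qed

text \<open>Let \<open>h\<close> and \<open>g\<close> flatten the cones over \<open>D\<close> and \<open>L\<close>. A point of the attached part is \<open>(z, t)\<close> with \<open>z\<close> over
  \<open>L\<close>, and \<open>g\<close> gives \<open>z\<close> a depth \<open>p = g z k\<close> inside \<open>L\<close>. The shear \<open>(p, t) \<mapsto> (p + t, t)\<close> moves \<open>z\<close> to a
  point \<open>x'\<close> of depth \<open>p + t\<close> and turns the attached part into the collar of all \<open>(x', t)\<close> with
  \<open>0 \<le> t \<le> f\<close>, where \<open>f\<close> is the depth of \<open>x'\<close>. Extended by 0 outside \<open>L\<close>, \<open>f\<close> is continuous on the bounding
  hyperplane of \<open>D\<close>, because that hyperplane is the union of the closed sets over \<open>L\<close> and \<open>M\<close>, which
  meet only where \<open>f = 0\<close>. Placing the collar below the hyperplane and raising everything over a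
  point of it by \<open>f\<close> produces the half space; the height of the point \<open>(z, t)\<close> becomes
  \<open>f - t = p\<close>.\<close>

lemma ball_Un_cone_ball:
  assumes V: "finite V"
    and D: "complex_on V D" and L: "complex_on V L" "L \<subseteq> D" and a: "a \<notin> V"
    and bD: "ball_like D BD (Suc k)" and bL: "ball_like L BL k"
    and M: "complex_on V M" "BD = L \<union> M" "L \<inter> M \<subseteq> BL"
  shows "ball_like (D \<union> cone_complex a L)
    {F \<in> D \<union> cone_complex a L. if F - {a} \<in> L then F - {a} \<in> BL else F \<in> BD} (Suc k)"
    (is "ball_like ?K ?B _")
proof -
  obtain h h' where hh: "conic_homeo (face_cone D) (half_space (Suc k)) h h'"
    and bdD: "\<And>x. x \<in> face_cone D \<Longrightarrow> h x (Suc k) = 0 \<longleftrightarrow> x \<in> face_cone BD"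
    using bD ball_like_def by blast
  obtain g g' where gg: "conic_homeo (face_cone L) (half_space k) g g'"
    and bdL: "\<And>x. x \<in> face_cone L \<Longrightarrow> g x k = 0 \<longleftrightarrow> x \<in> face_cone BL"
    using bL ball_like_def by blast
  note h = conic_homeoD[OF hh]
  note g = conic_homeoD[OF gg]
  define N where "N = Suc k"
  note h = h[folded N_def] and bdD = bdD[folded N_def]
  note LD = face_cone_mono[OF L(2)]
  have LBD: "face_cone L \<subseteq> face_cone BD" using M face_cone_mono by blast
  have Da: "x a = 0" "x(a := 0) = x" if "x \<in> face_cone D" for x
    using face_cone_outside[OF that D a] by auto
  have hN: "h x N \<ge> 0" if "x \<in> face_cone D" for x
    using h(3)[OF that] by (simp add: half_space_def)
  have gk: "g x k \<ge> 0" if "x \<in> face_cone L" for x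
    using g(3)[OF that] by (simp add: half_space_def)
  have cone: "x \<in> face_cone (cone_complex a L) \<longleftrightarrow> 0 \<le> x a \<and> x(a := 0) \<in> face_cone L" for x
    using face_cone_cone_iff[OF L(1) a] .
  have K: "face_cone ?K = face_cone (cone_complex a L) \<union> face_cone D"
    by (auto simp: face_cone_Un)
  have g'_scale: "g' (scale c y) = scale c (g' y)" if "y \<in> half_space k" "c > 0" for c y
    by (rule conic_homeo_inverse_scale[OF gg that]) (simp add: scale_in_face_cone_iff that)
  have h'_scale: "h' (scale c y) = scale c (h' y)" if "y \<in> half_space N" "c > 0" for c y
    using conic_homeo_inverse_scale[OF hh that[unfolded N_def]] that
    by (simp add: scale_in_face_cone_iff)

  define \<phi> where "\<phi> z = (if z \<in> face_cone L then g z k else 0)" for z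
  have \<phi>_cont: "continuous_on (face_cone BD) \<phi>"
    unfolding M(2) face_cone_Un \<phi>_def
  proof (rule continuous_on_If)
    show "closed (face_cone L)" "closed (face_cone M)"
      using closed_face_cone V L M by auto
    show "continuous_on (face_cone L) (\<lambda>z. g z k)"
      by (rule continuous_on_product_then_coordinatewise[OF g(1)])
    show "g z k = 0" if "z \<in> face_cone M" "z \<in> face_cone L" for z
    proof -
      have "z \<in> face_cone (L \<inter> M)" using that by (simp add: face_cone_Int)
      then show ?thesis using bdL[OF that(2)] face_cone_mono[OF M(3)] by blast
    qed
  qed auto
  have \<phi>_nonneg: "0 \<le> \<phi> z" for z using gk by (simp add: \<phi>_def)
  have \<phi>_scale: "\<phi> (scale c z) = c * \<phi> z" if "c > 0" for c z
    using that g(7) by (simp add: \<phi>_def scale_in_face_cone_iff)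

  define f where "f y = \<phi> (h' y)" for y
  have f_nonneg: "0 \<le> f y" for y using \<phi>_nonneg by (simp add: f_def)
  have half: "y \<in> half_space N" "y N = 0" if "y \<in> coord_space N" for y
    using that by (auto simp: half_space_def coord_space_def)
  have upd0: "y(N := 0) \<in> coord_space N" if "y \<in> half_space N" for y
    using that by (auto simp: half_space_def coord_space_def N_def not_less_eq_eq)
  have h'_BD: "h' y \<in> face_cone D" "h' y \<in> face_cone BD" if "y \<in> coord_space N" for y
    using bdD[of "h' y"] h half[OF that] by auto
  have f_cont: "continuous_on (coord_space N) f"
    unfolding f_def
    by (intro continuous_on_compose2[OF \<phi>_cont] continuous_on_subset[OF h(2)])
      (auto simp: h'_BD half)
  have f_scale: "f (scale c y) = c * f y" if "c > 0" "y \<in> coord_space N" for c y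
    using that half[of y] by (simp add: f_def h'_scale \<phi>_scale)

  \<comment> \<open>The first branch is shear, collar and lift combined, the second branch is the lift alone.\<close>
  define H where "H x = (if x(a := 0) \<in> face_cone L
     then (h (g' ((g (x(a := 0)))(k := g (x(a := 0)) k + x a))))(N := g (x(a := 0)) k)
     else (h x)(N := h x N + f ((h x)(N := 0))))" for x
  define H' where "H' y = (if f (y(N := 0)) - y N \<le> 0 then h' (y(N := y N - f (y(N := 0))))
     else (g' ((g (h' (y(N := 0))))(k := y N)))(a := f (y(N := 0)) - y N))" for y

  have H_cone: "g (x(a := 0)) \<in> half_space k"
      "(g (x(a := 0)))(k := g (x(a := 0)) k + x a) \<in> half_space k"
      "g' ((g (x(a := 0)))(k := g (x(a := 0)) k + x a)) \<in> face_cone L"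
      "h (g' ((g (x(a := 0)))(k := g (x(a := 0)) k + x a))) N = 0"
    if "x(a := 0) \<in> face_cone L" "0 \<le> x a" for x
  proof -
    show 1: "g (x(a := 0)) \<in> half_space k" using g that by blast
    then show 2: "(g (x(a := 0)))(k := g (x(a := 0)) k + x a) \<in> half_space k"
      by (rule half_space_upd) (use that gk in auto)
    then show 3: "g' ((g (x(a := 0)))(k := g (x(a := 0)) k + x a)) \<in> face_cone L"
      using g by blast
    then show "h (g' ((g (x(a := 0)))(k := g (x(a := 0)) k + x a))) N = 0"
      using bdD LD LBD by blast
  qed

  have "conic_homeo (face_cone ?K) (half_space N) H H'"
  proof (rule conic_homeoI)
    show "continuous_on (face_cone ?K) H"
      unfolding K H_def
    proof (rule continuous_on_If)
      show "closed (face_cone (cone_complex a L))"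
        by (rule closed_face_cone[OF _ complex_on_cone[OF L(1)]]) (use V in simp)
      show "closed (face_cone D)" using closed_face_cone V D by blast
      let ?g = "\<lambda>x. g (x(a := 0))"
      have gc: "continuous_on (face_cone (cone_complex a L)) ?g"
        by (intro continuous_on_compose2[OF g(1)] continuous_on_fun_upd continuous_on_id
            continuous_on_const) (auto simp: cone)
      note gk_cont = continuous_on_product_then_coordinatewise[OF gc]
      have "continuous_on (face_cone (cone_complex a L)) (\<lambda>x. (?g x)(k := ?g x k + x a))"
        by (intro continuous_on_fun_upd gc continuous_on_add gk_cont continuous_on_coordinate)
      then have "continuous_on (face_cone (cone_complex a L)) (\<lambda>x. g' ((?g x)(k := ?g x k + x a)))"
        by (rule continuous_on_compose2[OF g(2)]) (auto simp: cone H_cone)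
      then have "continuous_on (face_cone (cone_complex a L)) (\<lambda>x. h (g' ((?g x)(k := ?g x k + x a))))"
        by (rule continuous_on_compose2[OF h(1)]) (use LD H_cone(3) cone in blast)
      then show "continuous_on (face_cone (cone_complex a L))
          (\<lambda>x. (h (g' ((?g x)(k := ?g x k + x a))))(N := ?g x k))"
        by (intro continuous_on_fun_upd gk_cont)
      have "continuous_on (face_cone D) (\<lambda>x. (h x)(N := 0))"
        by (intro continuous_on_fun_upd h(1) continuous_on_const)
      then have "continuous_on (face_cone D) (\<lambda>x. f ((h x)(N := 0)))"
        by (rule continuous_on_compose2[OF f_cont]) (use upd0 h(3) in blast)
      then show "continuous_on (face_cone D) (\<lambda>x. (h x)(N := h x N + f ((h x)(N := 0))))"
        by (intro continuous_on_fun_upd h(1) continuous_on_add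
            continuous_on_product_then_coordinatewise[OF h(1)])
    next
      fix x assume x: "x \<in> face_cone D" "x(a := 0) \<in> face_cone L"
      then have xL: "x(a := 0) = x" "x a = 0" "x \<in> face_cone L" using Da by auto
      then have "h x N = 0" using bdD LD LBD by blast
      then have "(h x)(N := 0) = h x" by auto
      then have "f ((h x)(N := 0)) = g x k" using h(4) x xL by (simp add: f_def \<phi>_def)
      then show "(h (g' ((g (x(a := 0)))(k := g (x(a := 0)) k + x a))))(N := g (x(a := 0)) k)
          = (h x)(N := h x N + f ((h x)(N := 0)))"
        using xL g(4) \<open>h x N = 0\<close> by simp
    qed (auto simp: cone)
  next
    have f0: "continuous_on (half_space N) (\<lambda>y. f (y(N := 0)))"
      by (rule continuous_on_compose2[OF f_cont])
        (auto intro!: continuous_on_fun_upd continuous_on_id continuous_on_const simp: upd0)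
    show "continuous_on (half_space N) H'"
    proof -
      \<comment> \<open>Above the collar the inverse only lowers the point; inside it, the shear is undone as well.\<close>
      let ?S = "half_space N \<inter> (\<lambda>y. y N - f (y(N := 0))) -` {0..}"
      let ?T = "(half_space N \<inter> (\<lambda>y. h' (y(N := 0))) -` face_cone L)
        \<inter> (half_space N \<inter> (\<lambda>y. f (y(N := 0)) - y N) -` {0..})"
      have h0: "continuous_on (half_space N) (\<lambda>y. h' (y(N := 0)))"
        by (rule continuous_on_compose2[OF h(2)])
          (auto intro!: continuous_on_fun_upd continuous_on_id continuous_on_const half upd0)
      have cover: "half_space N = ?S \<union> ?T"
      proof -
        have "h' (y(N := 0)) \<in> face_cone L" if "y \<in> half_space N" "y N < f (y(N := 0))" for y
        proof -
          have "0 \<le> y N" using that by (simp add: half_space_def)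
          then have "f (y(N := 0)) \<noteq> 0" using that by linarith
          then show ?thesis by (auto simp: f_def \<phi>_def split: if_splits)
        qed
        then show ?thesis by force
      qed
      have "continuous_on (?S \<union> ?T) (\<lambda>y. if f (y(N := 0)) - y N \<le> 0 then h' (y(N := y N - f (y(N := 0))))
         else (g' ((g (h' (y(N := 0))))(k := y N)))(a := f (y(N := 0)) - y N))"
      proof (rule continuous_on_If)
        show "closed ?S"
          by (intro continuous_closed_preimage continuous_on_diff f0 continuous_on_coordinate
              closed_half_space closed_atLeast)
        show "closed ?T"
          by (intro closed_Int continuous_closed_preimage continuous_on_diff f0 h0
              continuous_on_coordinate closed_half_space closed_atLeast closed_face_cone[OF V L(1)])
        have "continuous_on ?S (\<lambda>y. y(N := y N - f (y(N := 0))))"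
          by (intro continuous_on_fun_upd continuous_on_id continuous_on_diff
              continuous_on_subset[OF f0] continuous_on_coordinate) auto
        then show "continuous_on ?S (\<lambda>y. h' (y(N := y N - f (y(N := 0)))))"
          by (rule continuous_on_compose2[OF h(2)]) (auto intro: half_space_upd)
        have "continuous_on ?T (\<lambda>y. g (h' (y(N := 0))))"
          by (rule continuous_on_compose2[OF g(1)]) (auto intro: continuous_on_subset[OF h0])
        then have "continuous_on ?T (\<lambda>y. (g (h' (y(N := 0))))(k := y N))"
          by (intro continuous_on_fun_upd continuous_on_coordinate)
        then have "continuous_on ?T (\<lambda>y. g' ((g (h' (y(N := 0))))(k := y N)))"
        proof (rule continuous_on_compose2[OF g(2)])
          show "(\<lambda>y. (g (h' (y(N := 0))))(k := y N)) ` ?T \<subseteq> half_space k"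
          proof
            fix u assume "u \<in> (\<lambda>y. (g (h' (y(N := 0))))(k := y N)) ` ?T"
            then obtain y where y: "u = (g (h' (y(N := 0))))(k := y N)" "y \<in> half_space N"
              "h' (y(N := 0)) \<in> face_cone L" by auto
            then show "u \<in> half_space k"
              using half_space_upd[OF g(3)[OF y(3)], of "y N"] by (simp add: half_space_def)
          qed
        qed
        then show "continuous_on ?T (\<lambda>y. (g' ((g (h' (y(N := 0))))(k := y N)))(a := f (y(N := 0)) - y N))"
          by (intro continuous_on_fun_upd continuous_on_diff continuous_on_coordinate
              continuous_on_subset[OF f0]) auto
      next
        fix y assume y: "y \<in> ?T" "f (y(N := 0)) - y N \<le> 0"
        then have L: "h' (y(N := 0)) \<in> face_cone L" and f: "f (y(N := 0)) = y N" by auto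
        then have "g (h' (y(N := 0))) k = y N" by (simp add: f_def \<phi>_def)
        then have "(g (h' (y(N := 0))))(k := y N) = g (h' (y(N := 0)))" by auto
        moreover have "(h' (y(N := 0)))(a := 0) = h' (y(N := 0))" using Da L LD by blast
        ultimately show "h' (y(N := y N - f (y(N := 0)))) =
            (g' ((g (h' (y(N := 0))))(k := y N)))(a := f (y(N := 0)) - y N)"
          using g(4)[OF L] f by simp
      qed auto
      then show ?thesis unfolding cover[symmetric] H'_def .
    qed
  next
    fix x assume x: "x \<in> face_cone ?K"
    then have "0 \<le> x a" by (simp add: face_cone_def)
    moreover have "x \<in> face_cone (cone_complex a L) \<or> x \<in> face_cone D" using x unfolding K by simp
    ultimately consider (apex) "x(a := 0) \<in> face_cone L" "0 \<le> x a"
      | (base) "x \<in> face_cone D" "x(a := 0) \<notin> face_cone L"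
      using cone[of x] by blast
    then show "H x \<in> half_space N \<and> H' (H x) = x"
    proof cases
      case apex
      define z v x' where "z = x(a := 0)" and "v = g z" and "x' = g' (v(k := v k + x a))"
      note d = z_def[symmetric] v_def[symmetric] x'_def[symmetric]
      note c = H_cone[OF apex, unfolded d]
      have H: "H x = (h x')(N := v k)" using apex by (simp add: H_def d)
      have z: "z \<in> face_cone L" using apex by (simp add: d)
      have vk: "0 \<le> v k" using gk[OF z] by (simp add: d)
      have hx': "h x' \<in> half_space N" using h(3) LD c(3) by blast
      have "(h x')(N := 0) = h x'" using c(4) by auto
      then have y0: "(H x)(N := 0) = h x'" by (simp add: H)
      have hh_x: "h' (h x') = x'" using h(4) LD c(3) by blast
      have gx': "g x' = v(k := v k + x a)" using g(6) c(2) by (simp add: x'_def)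
      have fy: "f (h x') = v k + x a" using c(3) gx' hh_x by (simp add: f_def \<phi>_def)
      have g'v: "g' v = z" using g(4) z by (simp add: v_def)
      have "H' (H x) = x"
      proof (cases "x a = 0")
        case True
        then have "H' (H x) = h' ((h x')(N := 0))"
          by (simp add: H'_def y0 fy) (simp add: H)
        also have "\<dots> = x'" using \<open>(h x')(N := 0) = h x'\<close> hh_x by simp
        also have "\<dots> = z" using True g'v by (simp add: x'_def)
        finally show ?thesis using True by (auto simp: z_def)
      next
        case False
        have e: "(g x')(k := v k) = v" by (simp add: gx')
        have "H' (H x) = (g' ((g x')(k := v k)))(a := x a)"
          using False apex(2) by (simp add: H'_def y0 fy hh_x) (simp add: H)
        then have "H' (H x) = z(a := x a)" by (simp only: e g'v)
        then show ?thesis by (simp add: z_def)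
      qed
      then show ?thesis using half_space_upd[OF hx' vk] H by simp
    next
      case base
      have H: "H x = (h x)(N := h x N + f ((h x)(N := 0)))" using base by (simp add: H_def)
      then have "H' (H x) = h' ((h x)(N := h x N))" using hN[OF base(1)] by (simp add: H'_def)
      then show ?thesis
        using h(3,4)[OF base(1)] hN[OF base(1)] f_nonneg half_space_upd H by simp
    qed
  next
    fix y assume y: "y \<in> half_space N"
    define y0 where "y0 = y(N := 0)"
    have y0: "y0 \<in> coord_space N" using upd0[OF y] by (simp add: y0_def)
    have yN: "0 \<le> y N" using y by (simp add: half_space_def)
    show "H' y \<in> face_cone ?K \<and> H (H' y) = y"
    proof (cases "f y0 - y N \<le> 0")
      case True
      define u where "u = y(N := y N - f y0)"
      have u: "u \<in> half_space N" using half_space_upd[OF y] True by (simp add: u_def)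
      have H': "H' y = h' u" using True by (simp add: H'_def u_def y0_def)
      have x: "h' u \<in> face_cone D" "h (h' u) = u" using h(5,6) u by auto
      have "H (h' u) = y"
      proof (cases "h' u \<in> face_cone L")
        case L: True
        then have "u N = 0" using bdD[OF x(1)] x(2) LBD by auto
        then have e: "f y0 = y N" "u = y0" by (auto simp: u_def y0_def)
        then have gy: "g (h' u) k = y N" using L by (simp add: f_def \<phi>_def)
        have "H (h' u) = (h (g' (g (h' u))))(N := g (h' u) k)"
          using L Da[OF x(1)] by (simp add: H_def)
        then have "H (h' u) = u(N := y N)" by (simp only: g(4)[OF L] x(2) gy)
        then show ?thesis by (simp add: u_def)
      next
        case False
        have "u(N := 0) = y0" by (simp add: u_def y0_def)
        then show ?thesis using False Da[OF x(1)] x by (simp add: H_def) (simp add: u_def)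
      qed
      then show ?thesis using H' x K by simp
    next
      case False
      define x' v w where "x' = h' y0" and "v = g x'" and "w = g' (v(k := y N))"
      have "f y0 \<noteq> 0" using False yN by linarith
      then have x': "x' \<in> face_cone L" "f y0 = v k"
        by (auto simp: f_def \<phi>_def x'_def v_def split: if_splits)
      have vy: "v(k := y N) \<in> half_space k"
        using half_space_upd[OF g(3)[OF x'(1)] yN] by (simp add: v_def)
      then have w: "w \<in> face_cone L" "g w = v(k := y N)" using g(5,6) by (auto simp: w_def)
      have wa: "w(a := 0) = w" using Da LD w by blast
      have H': "H' y = w(a := f y0 - y N)" using False
        by (simp add: H'_def w_def v_def x'_def y0_def)
      have "H' y \<in> face_cone (cone_complex a L)" using False w wa by (simp add: cone H')
      moreover have "H (H' y) = y"
      proof -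
        have "v(k := v k) = v" by simp
        then have 1: "H (H' y) = (h (g' v))(N := y N)"
          using w wa x'(2) by (simp add: H_def H')
        have 2: "g' v = x'" using g(4)[OF x'(1)] by (simp add: v_def)
        have 3: "h x' = y0" using h(6)[OF half(1)[OF y0]] by (simp add: x'_def)
        show ?thesis unfolding 1 2 3 by (simp add: y0_def)
      qed
      ultimately show ?thesis using K by simp
    qed
  next
    fix x c assume x: "x \<in> face_cone ?K" and c: "(c::real) > 0"
    show "H (scale c x) = scale c (H x)"
    proof (cases "x(a := 0) \<in> face_cone L")
      case True
      have xa: "0 \<le> x a" using x by (simp add: face_cone_def)
      note hc = H_cone[OF True xa]
      define z v where "z = x(a := 0)" and "v = g z"
      note d = z_def[symmetric] v_def[symmetric]
      have gz: "g (scale c z) = scale c v" using g(7)[OF _ c] True by (simp add: d)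
      have e: "(scale c v)(k := c * v k + c * x a) = scale c (v(k := v k + x a))"
        by (auto simp: scale_def distrib_left)
      have hx: "h (scale c (g' (v(k := v k + x a)))) = scale c (h (g' (v(k := v k + x a))))"
        using h(7)[OF _ c] hc(3) LD by (auto simp: d)
      have "scale c z \<in> face_cone L" using True by (simp add: d scale_in_face_cone_iff[OF c])
      then show ?thesis
        using True hc(2) unfolding H_def scale_fun_upd_0 d
        by (simp add: gz e g'_scale[OF _ c] hx) (auto simp: scale_def)
    next
      case False
      then have xD: "x \<in> face_cone D" using x K cone by auto
      have hx: "h (scale c x) = scale c (h x)" using h(7)[OF xD c] .
      have "f (scale c ((h x)(N := 0))) = c * f ((h x)(N := 0))"
        using f_scale[OF c] upd0 h(3)[OF xD] by blast
      then show ?thesis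
        using False
        by (simp add: H_def scale_fun_upd_0 hx scale_in_face_cone_iff[OF c]) (auto simp: scale_def distrib_left)
    qed
  qed
  moreover have "H x N = 0 \<longleftrightarrow> x \<in> face_cone ?B" if x: "x \<in> face_cone ?K" for x
  proof -
    have xK: "{v. x v \<noteq> 0} \<in> ?K" and nonneg: "\<forall>v. 0 \<le> x v" using x by (auto simp: face_cone_def)
    have supp: "x(a := 0) \<in> face_cone C \<longleftrightarrow> {v. x v \<noteq> 0} - {a} \<in> C" for C :: "'a set set"
      using nonneg by (auto simp: face_cone_def support_upd_0[symmetric])
    show ?thesis
    proof (cases "x(a := 0) \<in> face_cone L")
      case True
      then have "H x N = 0 \<longleftrightarrow> x(a := 0) \<in> face_cone BL" using bdL[OF True] by (simp add: H_def)
      also have "\<dots> \<longleftrightarrow> x \<in> face_cone ?B"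
        using True xK nonneg unfolding supp by (simp add: face_cone_def)
      finally show ?thesis .
    next
      case False
      then have xD: "x \<in> face_cone D" using x K cone by auto
      have "H x N = 0 \<longleftrightarrow> h x N = 0 \<and> f ((h x)(N := 0)) = 0"
        using False hN[OF xD] f_nonneg by (simp add: H_def add_nonneg_eq_0_iff)
      also have "\<dots> \<longleftrightarrow> h x N = 0"
      proof -
        have "f ((h x)(N := 0)) = 0" if "h x N = 0"
        proof -
          have "(h x)(N := 0) = h x" using that by auto
          then show ?thesis using False Da[OF xD] h(4)[OF xD] by (simp add: f_def \<phi>_def)
        qed
        then show ?thesis by blast
      qed
      also have "\<dots> \<longleftrightarrow> x \<in> face_cone BD" by (rule bdD[OF xD])
      also have "\<dots> \<longleftrightarrow> x \<in> face_cone ?B"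
        using False xK nonneg unfolding supp by (simp add: face_cone_def)
      finally show ?thesis .
    qed
  qed
  ultimately show ?thesis unfolding ball_like_def N_def by blast
qed

section \<open>From cones to geometric realizations\<close>

lemma homeomorphic_imp_homeomorphic_space:
  "X homeomorphic Y \<Longrightarrow> top_of_set X homeomorphic_space top_of_set Y"
proof -
  assume "X homeomorphic Y"
  then obtain f g where "homeomorphism X Y f g" by (auto simp: homeomorphic_def)
  then have "homeomorphic_maps (top_of_set X) (top_of_set Y) f g"
    unfolding homeomorphism_def homeomorphic_maps_def by auto
  then show ?thesis unfolding homeomorphic_space_def by blast
qed

lemma scale_zero [simp]: "scale c (\<lambda>_. 0) = (\<lambda>_. 0)"
  by (simp add: scale_def)

lemma continuous_on_scale:
  assumes "continuous_on X c" "continuous_on X f"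
  shows "continuous_on X (\<lambda>x. scale (c x) (f x))"
  unfolding scale_def
  by (intro continuous_on_coordinatewise_then_product continuous_on_mult assms
      continuous_on_product_then_coordinatewise[OF assms(2)])

text \<open>Functions such as the sum of the coordinates or the Euclidean norm, whose level set at 1 meets every ray of the
  cone \<open>X\<close> exactly once.\<close>

definition gauge_on :: "('v \<Rightarrow> real) set \<Rightarrow> (('v \<Rightarrow> real) \<Rightarrow> real) \<Rightarrow> bool" where
  "gauge_on X p \<longleftrightarrow> continuous_on X p \<and> (\<forall>x\<in>X. \<forall>c>0. p (scale c x) = c * p x) \<and>
     (\<forall>x\<in>X. x \<noteq> (\<lambda>_. 0) \<longrightarrow> 0 < p x) \<and> p (\<lambda>_. 0) = 0"

lemma conic_homeo_sym:
  assumes "conic_homeo X Y h h'" "\<And>x c. \<lbrakk>x \<in> X; c > 0\<rbrakk> \<Longrightarrow> scale c x \<in> X"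
  shows "conic_homeo Y X h' h"
  using conic_homeo_inverse_scale[OF assms(1)] assms
  unfolding conic_homeo_def by (simp add: homeomorphism_symD)

text \<open>A homogeneous homeomorphism between cones induces one between any two sections of them that meet every ray
  once: map and rescale.\<close>

lemma conic_homeo_normalize:
  assumes hh: "conic_homeo X Y h h'"
    and Y: "(\<lambda>_. 0) \<in> Y" "\<And>y c. \<lbrakk>y \<in> Y; c > 0\<rbrakk> \<Longrightarrow> scale c y \<in> Y"
    and X: "(\<lambda>_. 0) \<in> X" "\<And>x c. \<lbrakk>x \<in> X; c > 0\<rbrakk> \<Longrightarrow> scale c x \<in> X"
    and p: "gauge_on X p" and q: "gauge_on Y q"
  defines "u \<equiv> \<lambda>x. scale (1 / q (h x)) (h x)" and "u' \<equiv> \<lambda>y. scale (1 / p (h' y)) (h' y)"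
  shows "continuous_on {x \<in> X. p x = 1} u"
    and "x \<in> X \<Longrightarrow> p x = 1 \<Longrightarrow> u x \<in> Y \<and> q (u x) = 1 \<and> u' (u x) = x"
proof -
  note h = conic_homeoD[OF hh]
  have h0: "h (\<lambda>_. 0) = (\<lambda>_. 0)"
  proof -
    have "h (\<lambda>_. 0) = scale 2 (h (\<lambda>_. 0))" using h(7)[OF X(1), of 2] by simp
    then have "h (\<lambda>_. 0) v = 2 * h (\<lambda>_. 0) v" for v by (subst (asm) fun_eq_iff) auto
    then show ?thesis by (simp add: fun_eq_iff)
  qed
  have pos: "0 < q (h x)" if "x \<in> X" "p x = 1" for x
  proof -
    have "x \<noteq> (\<lambda>_. 0)" using that p by (auto simp: gauge_on_def)
    then have "h x \<noteq> (\<lambda>_. 0)" using h(4)[OF that(1)] h(4)[OF X(1)] h0 by auto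
    then show ?thesis using q h(3)[OF that(1)] by (auto simp: gauge_on_def)
  qed
  have qh: "continuous_on {x \<in> X. p x = 1} (\<lambda>x. q (h x))"
    by (rule continuous_on_compose2[of Y q]) (use q h in \<open>auto simp: gauge_on_def intro: continuous_on_subset\<close>)
  show "continuous_on {x \<in> X. p x = 1} u"
    unfolding u_def
    by (intro continuous_on_scale continuous_on_divide continuous_on_const qh
        continuous_on_subset[OF h(1)]) (use pos in fastforce)+
  show "u x \<in> Y \<and> q (u x) = 1 \<and> u' (u x) = x" if x: "x \<in> X" "p x = 1"
  proof -
    define c where "c = 1 / q (h x)"
    have c: "c > 0" "c * q (h x) = 1" using pos[OF x] by (auto simp: c_def)
    have u: "u x = scale c (h x)" by (simp add: u_def c_def)
    have uY: "u x \<in> Y" using Y(2)[OF h(3)[OF x(1)] c(1)] u by simp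
    have "q (u x) = c * q (h x)" using q h(3)[OF x(1)] c u by (simp add: gauge_on_def)
    moreover have h'u: "h' (u x) = scale c x"
      using conic_homeo_inverse_scale[OF hh h(3)[OF x(1)] c(1)] X(2) c(1) h(4)[OF x(1)] u by simp
    moreover have "p (scale c x) = c" using p x c by (simp add: gauge_on_def)
    ultimately show ?thesis using c uY by (simp add: u'_def)
  qed
qed

lemma conic_homeo_sections:
  assumes hh: "conic_homeo X Y h h'"
    and X: "(\<lambda>_. 0) \<in> X" "\<And>x c. \<lbrakk>x \<in> X; c > 0\<rbrakk> \<Longrightarrow> scale c x \<in> X"
    and Y: "(\<lambda>_. 0) \<in> Y" "\<And>y c. \<lbrakk>y \<in> Y; c > 0\<rbrakk> \<Longrightarrow> scale c y \<in> Y"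
    and p: "gauge_on X p" and q: "gauge_on Y q"
  shows "{x \<in> X. p x = 1} homeomorphic {y \<in> Y. q y = 1}"
proof -
  note n = conic_homeo_normalize[OF hh Y X p q]
  note n' = conic_homeo_normalize[OF conic_homeo_sym[OF hh X(2)] X Y q p]
  show ?thesis
    unfolding homeomorphic_def
    by (intro exI homeomorphismI) (use n n' in auto)
qed

lemma gauge_on_sum:
  assumes "finite V" "complex_on V K"
  shows "gauge_on (face_cone K) (\<lambda>x. sum x V)"
  unfolding gauge_on_def
proof (intro conjI ballI impI allI)
  show "continuous_on (face_cone K) (\<lambda>x. sum x V)"
    by (intro continuous_on_sum continuous_on_coordinate)
  fix x assume x: "x \<in> face_cone K"
  show "sum (scale c x) V = c * sum x V" for c by (simp add: scale_def sum_distrib_left)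
  assume "x \<noteq> (\<lambda>_. 0)"
  then obtain v where "x v \<noteq> 0" by auto
  moreover from this have "v \<in> V" using face_cone_outside[OF x assms(2)] by blast
  ultimately show "0 < sum x V"
    using x assms by (intro sum_pos2[of _ v]) (auto simp: face_cone_def order_less_le)
qed auto

definition coord_norm :: "nat \<Rightarrow> (nat \<Rightarrow> real) \<Rightarrow> real" where
  "coord_norm n y = sqrt (\<Sum>i<n. (y i)\<^sup>2)"

lemma gauge_on_coord_norm: "gauge_on (coord_space n) (coord_norm n)"
  unfolding gauge_on_def coord_norm_def
proof (intro conjI ballI impI allI)
  show "continuous_on (coord_space n) (\<lambda>y. sqrt (\<Sum>i<n. (y i)\<^sup>2))"
    by (intro continuous_on_real_sqrt continuous_on_sum continuous_on_power continuous_on_coordinate)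
  fix y :: "nat \<Rightarrow> real" assume y: "y \<in> coord_space n"
  show "sqrt (\<Sum>i<n. (scale c y i)\<^sup>2) = c * sqrt (\<Sum>i<n. (y i)\<^sup>2)" if "c > 0" for c
    using that by (simp add: power_mult_distrib real_sqrt_mult flip: sum_distrib_left)
  assume "y \<noteq> (\<lambda>_. 0)"
  then obtain i where "y i \<noteq> 0" by auto
  moreover from this have "i < n" using y by (auto simp: coord_space_def not_less[symmetric])
  ultimately have "0 < (\<Sum>i<n. (y i)\<^sup>2)" by (intro sum_pos2[of _ i]) auto
  then show "0 < sqrt (\<Sum>i<n. (y i)\<^sup>2)" by simp
qed auto

lemma gauge_on_subset: "\<lbrakk>gauge_on X p; Y \<subseteq> X\<rbrakk> \<Longrightarrow> gauge_on Y p"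
  unfolding gauge_on_def by (auto intro: continuous_on_subset)

lemma realization_eq:
  assumes "finite V" "complex_on V K"
  shows "realization K = top_of_set {x \<in> face_cone K. sum x V = 1}"
proof -
  have "(\<Sum>v | x v \<noteq> 0. x v) = sum x V" if "{v. x v \<noteq> 0} \<in> K" for x :: "'a \<Rightarrow> real"
  proof (rule sum.mono_neutral_left[OF assms(1)])
    show "{v. x v \<noteq> 0} \<subseteq> V" using assms that unfolding complex_on_def by blast
  qed auto
  then show ?thesis
    unfolding realization_def euclidean_product_topology face_cone_def
    by (intro arg_cong[where f = "subtopology euclidean"]) auto
qed

lemma zero_in_face_cone: "{} \<in> K \<Longrightarrow> (\<lambda>_. 0) \<in> face_cone K"
  by (simp add: face_cone_def)

lemma nsphere_eq: "nsphere n = top_of_set {y \<in> coord_space (Suc n). coord_norm (Suc n) y = 1}"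
  unfolding nsphere euclidean_product_topology coord_norm_def coord_space_def
  by (intro arg_cong[where f = "subtopology euclidean"])
    (auto simp: lessThan_Suc_atMost Suc_le_eq)

text \<open>For \<open>n = 0\<close> the cone is a single point, so the complex has no vertex and is the sphere of dimension -1.\<close>

lemma sphere_like_imp_is_sphere:
  assumes "finite V" "complex_on V K" "{} \<in> K" "sphere_like K n"
  shows "is_sphere K"
proof -
  obtain h h' where hh: "conic_homeo (face_cone K) (coord_space n) h h'"
    using assms sphere_like_def by blast
  show ?thesis
  proof (cases n)
    case 0
    have "F = {}" if "F \<in> K" for F
    proof -
      define x where "x = (\<lambda>v. if v \<in> F then 1 else 0 :: real)"
      have x: "x \<in> face_cone K" using that by (simp add: face_cone_def x_def)
      have "h x = h (\<lambda>_. 0)"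
        using conic_homeoD(3)[OF hh] x zero_in_face_cone[OF assms(3)] 0 by (auto simp: coord_space_def)
      then have "x = (\<lambda>_. 0)"
        using conic_homeoD(4)[OF hh] x zero_in_face_cone[OF assms(3)] by metis
      then have "x v = 0" for v by simp
      then show ?thesis unfolding x_def by (metis equals0I zero_neq_one)
    qed
    then have "K = {{}}" using assms by auto
    then show ?thesis by (simp add: is_sphere_def)
  next
    case (Suc d)
    have "{x \<in> face_cone K. sum x V = 1} homeomorphic {y \<in> coord_space (Suc d). coord_norm (Suc d) y = 1}"
      using hh[unfolded Suc]
      by (rule conic_homeo_sections)
        (use assms in \<open>auto simp: scale_in_face_cone_iff scale_in_coord_space zero_in_face_cone
            gauge_on_sum gauge_on_coord_norm, simp add: coord_space_def\<close>)
    then show ?thesis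
      unfolding is_sphere_def realization_eq[OF assms(1,2)] nsphere_eq
      using homeomorphic_imp_homeomorphic_space by blast
  qed
qed

text \<open>Orthogonal projection along the last coordinate.\<close>

lemma half_sphere_homeomorphic_ball:
  "{y \<in> half_space n. coord_norm (Suc n) y = 1} homeomorphic {y \<in> coord_space n. (\<Sum>i<n. (y i)\<^sup>2) \<le> 1}"
  unfolding homeomorphic_def
proof (intro exI homeomorphismI)
  let ?X = "{y \<in> half_space n. coord_norm (Suc n) y = 1}"
  let ?Y = "{y \<in> coord_space n. (\<Sum>i<n. (y i)\<^sup>2) \<le> (1::real)}"
  let ?f = "\<lambda>y :: nat \<Rightarrow> real. y(n := 0)"
  let ?g = "\<lambda>y :: nat \<Rightarrow> real. y(n := sqrt (1 - (\<Sum>i<n. (y i)\<^sup>2)))"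
  have eq1: "(\<Sum>i<Suc n. (y i)\<^sup>2) = 1" "y n = sqrt (1 - (\<Sum>i<n. (y i)\<^sup>2))" if "y \<in> ?X" for y
  proof -
    show 1: "(\<Sum>i<Suc n. (y i)\<^sup>2) = 1" using that by (simp add: coord_norm_def del: sum.lessThan_Suc)
    then have "(y n)\<^sup>2 = 1 - (\<Sum>i<n. (y i)\<^sup>2)" by simp
    then show "y n = sqrt (1 - (\<Sum>i<n. (y i)\<^sup>2))"
      using that by (metis (no_types, lifting) half_space_def mem_Collect_eq real_sqrt_unique)
  qed
  show "continuous_on ?X ?f"
    by (intro continuous_on_fun_upd continuous_on_id continuous_on_const)
  show "continuous_on ?Y ?g"
    by (intro continuous_on_fun_upd continuous_on_id continuous_on_real_sqrt continuous_on_diff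
        continuous_on_const continuous_on_sum continuous_on_power continuous_on_coordinate)
  show "?f ` ?X \<subseteq> ?Y"
  proof
    fix z assume "z \<in> ?f ` ?X"
    then obtain y where y: "z = ?f y" "y \<in> ?X" by blast
    have "(\<Sum>i<n. (y i)\<^sup>2) \<le> 1" using eq1(1)[OF y(2)] by simp (metis add_increasing2 order.eq_iff zero_le_power2)
    then show "z \<in> ?Y"
      using y half_space_upd[of y n 0] half_space_0_iff[of z n] by simp
  qed
  show "?g ` ?Y \<subseteq> ?X"
    by (auto simp: half_space_def coord_norm_def coord_space_upd)
  show "?g (?f y) = y" if "y \<in> ?X" for y
    using eq1(2)[OF that] by auto
  show "?f (?g y) = y" if "y \<in> ?Y" for y
    using that by (auto simp: coord_space_def)
qed

lemma nball_eq: "nball n = top_of_set {y \<in> coord_space n. (\<Sum>i<n. (y i)\<^sup>2) \<le> 1}"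
  unfolding nball_def Euclidean_space_def subtopology_subtopology euclidean_product_topology coord_space_def
  by (intro arg_cong[where f = "subtopology euclidean"]) auto

lemma ball_like_imp_is_ball:
  assumes "finite V" "complex_on V K" "{} \<in> K" "ball_like K B n"
  shows "is_ball K"
proof -
  obtain h h' where hh: "conic_homeo (face_cone K) (half_space n) h h'"
    using assms ball_like_def by blast
  have g: "gauge_on (half_space n) (coord_norm (Suc n))"
    by (rule gauge_on_subset[OF gauge_on_coord_norm]) (auto simp: half_space_def)
  have "{x \<in> face_cone K. sum x V = 1} homeomorphic {y \<in> half_space n. coord_norm (Suc n) y = 1}"
    using hh
    by (rule conic_homeo_sections)
      (use assms g in \<open>auto simp: scale_in_face_cone_iff scale_in_half_space zero_in_face_cone
          gauge_on_sum, simp add: half_space_def coord_space_def\<close>)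
  then have "{x \<in> face_cone K. sum x V = 1} homeomorphic {y \<in> coord_space n. (\<Sum>i<n. (y i)\<^sup>2) \<le> 1}"
    using half_sphere_homeomorphic_ball homeomorphic_trans by blast
  then show ?thesis
    unfolding is_ball_def realization_eq[OF assms(1,2)] nball_eq
    using homeomorphic_imp_homeomorphic_space by blast
qed

context coxeter_group begin

section \<open>The topological type of a subword complex\<close>

abbreviation word :: "'a list \<Rightarrow> nat set \<Rightarrow> 'a list" where
  "word Q F \<equiv> nths Q (- F)"

lemma word_in_lists: "Q \<in> lists S \<Longrightarrow> nths Q A \<in> lists S"
  by (auto dest: in_set_nthsD)

lemma word_antimono: "F \<subseteq> F' \<Longrightarrow> subseq (word Q F') (word Q F)"
  by (intro subseq_nths_mono) auto

lemma word_snoc: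
  "word (Q @ [s]) F = word Q (F - {length Q}) @ (if length Q \<in> F then [] else [s])"
proof -
  have "nths Q (- F) = nths Q (- (F - {length Q}))"
    by (rule nths_cong) auto
  then show ?thesis by (simp add: nths_snoc)
qed

lemma subword_complex_iff:
  "F \<in> subword_complex G S Q w \<longleftrightarrow> F \<subseteq> {..<length Q} \<and> contains G S (word Q F) w"
proof -
  have eq: "nths Q P = word Q ({..<length Q} - P)" for P
    by (rule nths_cong) auto
  show ?thesis
  proof
    assume "F \<in> subword_complex G S Q w"
    then obtain P where "F = {..<length Q} - P" "contains G S (nths Q P) w"
      unfolding subword_complex_def by blast
    then show "F \<subseteq> {..<length Q} \<and> contains G S (word Q F) w" using eq[of P] by simp
  next
    assume F: "F \<subseteq> {..<length Q} \<and> contains G S (word Q F) w"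
    let ?P = "{..<length Q} - F"
    have "F = {..<length Q} - ?P" using F by auto
    then have "F = {..<length Q} - ?P \<and> ?P \<subseteq> {..<length Q} \<and> contains G S (nths Q ?P) w"
      using F eq[of ?P] by auto
    then show "F \<in> subword_complex G S Q w" unfolding subword_complex_def by blast
  qed
qed

lemma subword_complex_complex: "complex_on {..<length Q} (subword_complex G S Q w)"
  unfolding complex_on_def
proof (intro conjI ballI allI impI)
  show "subword_complex G S Q w \<subseteq> Pow {..<length Q}" by (auto simp: subword_complex_iff)
  fix F F' assume F: "F \<in> subword_complex G S Q w" "F' \<subseteq> F"
  then show "F' \<in> subword_complex G S Q w"
    using contains_mono[OF _ word_antimono[OF F(2)]] unfolding subword_complex_iff by blast
qed

text \<open>The boundary as the theorem predicts it. The topological induction works with this set; that it agrees with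
  the boundary given by the codimension 1 faces is shown separately, without topology.\<close>

definition demazure_boundary :: "'a list \<Rightarrow> 'a \<Rightarrow> nat set set" where
  "demazure_boundary Q w = {F \<in> subword_complex G S Q w. dem (word Q F) \<noteq> w}"

lemma demazure_boundary_iff:
  "F \<in> demazure_boundary Q w \<longleftrightarrow> F \<in> subword_complex G S Q w \<and> dem (word Q F) \<noteq> w"
  by (simp add: demazure_boundary_def)

text \<open>A subword of \<open>P'\<close> that still contains the longest element contained in \<open>P'\<close> has the same Demazure product.
  Hence the faces in the boundary form a complex.\<close>

lemma dem_subseq_eq:
  assumes "P' \<in> lists S" "subseq P P'" "contains G S P w" "dem P' = w"
  shows "dem P = w"
proof -
  have P: "P \<in> lists S" using assms subseq_lists by blast
  have "contains G S P' (dem P)" using contains_dem[OF P] assms(2) contains_mono by blast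
  then have "len (dem P) < len w \<or> dem P = w" using contains_maximal[OF assms(1)] assms(4) by blast
  then show ?thesis using contains_maximal[OF P assms(3)] by auto
qed

lemma demazure_boundary_complex:
  assumes "Q \<in> lists S"
  shows "complex_on {..<length Q} (demazure_boundary Q w)"
  unfolding complex_on_def
proof (intro conjI ballI allI impI)
  show "demazure_boundary Q w \<subseteq> Pow {..<length Q}"
    by (auto simp: demazure_boundary_iff subword_complex_iff)
  fix F F' assume F: "F \<in> demazure_boundary Q w" "F' \<subseteq> F"
  then have "F' \<in> subword_complex G S Q w"
    using subword_complex_complex[of Q w] by (auto simp: demazure_boundary_iff complex_on_def)
  moreover have "dem (word Q F') \<noteq> w"
    using F dem_subseq_eq[OF word_in_lists[OF assms] word_antimono[OF F(2)]]
    by (auto simp: demazure_boundary_iff subword_complex_iff)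
  ultimately show "F' \<in> demazure_boundary Q w" by (simp add: demazure_boundary_iff)
qed

lemma subword_complex_snoc_iff:
  assumes "Q \<in> lists S" "s \<in> S" "w \<in> carrier G"
  shows "F \<in> subword_complex G S (Q @ [s]) w \<longleftrightarrow> F - {length Q} \<in> subword_complex G S Q
    (if length Q \<in> F \<or> \<not> len (w \<otimes> s) < len w then w else w \<otimes> s)"
proof -
  have "F \<subseteq> {..<length (Q @ [s])} \<longleftrightarrow> F - {length Q} \<subseteq> {..<length Q}" by (auto simp: less_Suc_eq)
  then show ?thesis
    using contains_snoc[OF word_in_lists[OF assms(1)] assms(2,3)]
    by (simp add: subword_complex_iff word_snoc)
qed

lemma subword_complex_snoc_up:
  assumes Q: "Q \<in> lists S" "s \<in> S" "w \<in> carrier G" and up: "\<not> len (w \<otimes> s) < len w"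
  shows "subword_complex G S (Q @ [s]) w = cone_complex (length Q) (subword_complex G S Q w)"
    and "demazure_boundary (Q @ [s]) w =
      subword_complex G S Q w \<union> cone_complex (length Q) (demazure_boundary Q w)"
proof -
  have nV: "length Q \<notin> {..<length Q}" by simp
  note mem = subword_complex_snoc_iff[OF Q] cone_complex_iff[OF subword_complex_complex nV]
    cone_complex_iff[OF demazure_boundary_complex[OF Q(1)] nV]
  show "subword_complex G S (Q @ [s]) w = cone_complex (length Q) (subword_complex G S Q w)"
    using up by (intro Set.set_eqI) (simp add: mem)
  show "demazure_boundary (Q @ [s]) w =
      subword_complex G S Q w \<union> cone_complex (length Q) (demazure_boundary Q w)"
  proof (intro Set.set_eqI)
    fix F
    have base: "F \<in> subword_complex G S Q w \<longleftrightarrow> length Q \<notin> F \<and> F - {length Q} \<in> subword_complex G S Q w"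
      by (cases "length Q \<in> F") (auto simp: subword_complex_iff)
    have descent: "dem (word (Q @ [s]) F) \<noteq> w" if "length Q \<notin> F"
      using that dem_snoc_eq_iff[OF word_in_lists[OF Q(1)] Q(2,3)] up by (simp add: word_snoc)
    show "F \<in> demazure_boundary (Q @ [s]) w \<longleftrightarrow>
        F \<in> subword_complex G S Q w \<union> cone_complex (length Q) (demazure_boundary Q w)"
    proof (cases "length Q \<in> F")
      case True
      then show ?thesis using base by (simp add: demazure_boundary_iff mem word_snoc)
    next
      case False
      then have "F - {length Q} = F" by auto
      then show ?thesis using base up False descent[OF False] by (auto simp: demazure_boundary_iff mem)
    qed
  qed
qed

lemma subword_complex_snoc_down:
  assumes Q: "Q \<in> lists S" "s \<in> S" "w \<in> carrier G" and down: "len (w \<otimes> s) < len w"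
  shows "subword_complex G S Q w \<subseteq> subword_complex G S Q (w \<otimes> s)"
    and "subword_complex G S (Q @ [s]) w =
      subword_complex G S Q (w \<otimes> s) \<union> cone_complex (length Q) (subword_complex G S Q w)"
proof -
  show sub: "subword_complex G S Q w \<subseteq> subword_complex G S Q (w \<otimes> s)"
    using contains_descent[OF _ word_in_lists[OF Q(1)] Q(2) down] by (auto simp: subword_complex_iff)
  have nV: "length Q \<notin> {..<length Q}" by simp
  show "subword_complex G S (Q @ [s]) w =
      subword_complex G S Q (w \<otimes> s) \<union> cone_complex (length Q) (subword_complex G S Q w)"
  proof (intro Set.set_eqI)
    fix F
    have "length Q \<notin> F" if "F \<in> subword_complex G S Q v" for v
      using that by (auto simp: subword_complex_iff)
    then show "F \<in> subword_complex G S (Q @ [s]) w \<longleftrightarrow>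
      F \<in> subword_complex G S Q (w \<otimes> s) \<union> cone_complex (length Q) (subword_complex G S Q w)"
      using down sub
      by (cases "length Q \<in> F")
        (auto simp: subword_complex_snoc_iff[OF Q] cone_complex_iff[OF subword_complex_complex nV])
  qed
qed

text \<open>So \<open>\<Delta>(Q, w)\<close> lies in the boundary of \<open>\<Delta>(Q, w s)\<close>.\<close>

lemma in_subword_complex_dem:
  assumes Q: "Q \<in> lists S" "s \<in> S" "w \<in> carrier G" and down: "len (w \<otimes> s) < len w"
    and F: "F \<in> subword_complex G S Q w"
  shows "dem (word Q F) \<noteq> w \<otimes> s"
  using contains_maximal[OF word_in_lists[OF Q(1)], of "- F" w] F down
  by (auto simp: subword_complex_iff)

text \<open>The number \<open>d\<close> is the dimension of the space or half space that models the cone, one more than the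
  dimension of the complex. Tracking it shows that \<open>L\<close>, if it has any face, has codimension 1 in
  \<open>D\<close>, as the lemmas on attached cones demand.\<close>

lemma subword_complex_ball_or_sphere:
  assumes "Q \<in> lists S" "contains G S Q w"
  shows "\<exists>d. length Q = len w + d \<and>
    (dem Q = w \<and> sphere_like (subword_complex G S Q w) d \<or>
     dem Q \<noteq> w \<and> (\<exists>k. d = Suc k \<and> ball_like (subword_complex G S Q w) (demazure_boundary Q w) k))"
  using assms
proof (induction Q arbitrary: w rule: rev_induct)
  case Nil
  then have w: "w = \<one>" by (simp add: contains_Nil_iff)
  have "len \<one> = 0" using len_le[of "[]"] by simp
  moreover have "subword_complex G S [] \<one> = {{}}"
    by (auto simp: subword_complex_iff contains_Nil_iff)
  ultimately show ?case using w sphere_like_point by simp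
next
  case (snoc s Q)
  have Q: "Q \<in> lists S" "s \<in> S" using snoc.prems by auto
  have w: "w \<in> carrier G" using snoc.prems contains_closed by blast
  define n where "n = length Q"
  have V: "finite {..<n}" "n \<notin> {..<n}" by auto
  define L where "L = subword_complex G S Q w"
  define K where "K = subword_complex G S (Q @ [s]) w"
  note cplx = subword_complex_complex[of Q, folded n_def]
  have Lc: "complex_on {..<n} L" unfolding L_def by (rule cplx)
  show ?case
  proof (cases "len (w \<otimes> s) < len w")
    case up: False
    have "contains G S Q w" using snoc.prems contains_snoc[OF Q w] up by simp
    then obtain d where d: "length Q = len w + d"
      and IH: "dem Q = w \<and> sphere_like L d \<or>
        dem Q \<noteq> w \<and> (\<exists>k. d = Suc k \<and> ball_like L (demazure_boundary Q w) k)"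
      using snoc.IH[OF Q(1)] unfolding L_def by blast
    have ne: "dem (Q @ [s]) \<noteq> w" using dem_snoc_eq_iff[OF Q w] up by simp
    note K = subword_complex_snoc_up[OF Q w up, folded n_def L_def K_def]
    have "ball_like K (demazure_boundary (Q @ [s]) w) d"
      using IH
    proof (elim disjE conjE exE)
      assume "dem Q = w" and s: "sphere_like L d"
      then have "demazure_boundary Q w = {}"
        using dem_subseq_eq[OF Q(1) subseq_conv_nths[THEN iffD2, OF exI, OF refl]]
        by (auto simp: demazure_boundary_iff subword_complex_iff)
      then show ?thesis unfolding K using cone_sphere[OF Lc V(2) s] by (simp add: cone_complex_def)
    next
      fix k assume "d = Suc k" "ball_like L (demazure_boundary Q w) k"
      moreover have "demazure_boundary Q w \<subseteq> L" by (auto simp: demazure_boundary_iff L_def)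
      ultimately show ?thesis
        unfolding K using cone_ball[OF Lc V(2)] demazure_boundary_complex[OF Q(1), of w, folded n_def]
        by blast
    qed
    then show ?thesis using d ne unfolding K_def by (intro exI[of _ "Suc d"]) simp
  next
    case down: True
    define v where "v = w \<otimes> s"
    define D where "D = subword_complex G S Q v"
    have Dc: "complex_on {..<n} D" unfolding D_def by (rule cplx)
    have lw: "len w = Suc (len v)" using len_mult_S_down[OF w Q(2)] down by (simp add: v_def)
    have dem: "dem (P @ [s]) = w \<longleftrightarrow> dem P = w \<or> dem P = v" if "P \<in> lists S" for P
      using dem_snoc_eq_iff[OF that Q(2) w] down by (simp add: v_def)
    note LD = subword_complex_snoc_down(1)[OF Q w down, folded v_def, folded L_def D_def]
    note K = subword_complex_snoc_down(2)[OF Q w down, folded v_def, folded L_def D_def n_def K_def]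
    have Lv: "dem (word Q F) \<noteq> v" if "F \<in> L" for F
      using in_subword_complex_dem[OF Q w down] that unfolding L_def v_def by blast
    have Dn: "n \<notin> F" if "F \<in> D" for F using that by (auto simp: D_def subword_complex_iff n_def)
    have word_D: "word (Q @ [s]) F = word Q F @ [s]" if "n \<notin> F" for F
      using that by (simp add: word_snoc n_def)
    have Lw: "F \<in> L" if "F \<in> D" "dem (word Q F) = w" for F
      using that contains_dem[OF word_in_lists[OF Q(1)], of "- F"]
      by (auto simp: L_def D_def subword_complex_iff)
    have "contains G S Q v" using snoc.prems contains_snoc[OF Q w] down by (simp add: v_def)
    then obtain d' where d': "length Q = len v + d'"
      and IHv: "dem Q = v \<and> sphere_like D d' \<or>
        dem Q \<noteq> v \<and> (\<exists>k. d' = Suc k \<and> ball_like D (demazure_boundary Q v) k)"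
      using snoc.IH[OF Q(1)] unfolding D_def by blast
    show ?thesis
    proof (cases "contains G S Q w")
      case False
      then have ne: "dem Q \<noteq> w" using contains_dem[OF Q(1)] by auto
      have "L = {}"
        using False contains_mono[OF _ subseq_conv_nths[THEN iffD2, OF exI, OF refl]]
        by (auto simp: L_def subword_complex_iff)
      then have KD: "K = D" unfolding K cone_complex_def by simp
      have "demazure_boundary (Q @ [s]) w = demazure_boundary Q v"
      proof (intro Set.set_eqI)
        fix F
        have "dem (word (Q @ [s]) F) = w \<longleftrightarrow> dem (word Q F) = v" if "F \<in> D"
          using word_D[OF Dn[OF that]] dem[OF word_in_lists[OF Q(1)]] Lw[OF that] \<open>L = {}\<close> by auto
        then show "F \<in> demazure_boundary (Q @ [s]) w \<longleftrightarrow> F \<in> demazure_boundary Q v"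
          unfolding demazure_boundary_iff K_def[symmetric] D_def[symmetric] KD by auto
      qed
      then show ?thesis
        using IHv ne dem[OF Q(1)] d' lw KD unfolding K_def[symmetric]
        by (intro exI[of _ d']) simp
    next
      case True
      then obtain d where d: "length Q = len w + d"
        and IHw: "dem Q = w \<and> sphere_like L d \<or>
          dem Q \<noteq> w \<and> (\<exists>k. d = Suc k \<and> ball_like L (demazure_boundary Q w) k)"
        using snoc.IH[OF Q(1)] unfolding L_def by blast
      have "d' = Suc d" using d d' lw by simp
      moreover have "dem Q \<noteq> v" using contains_maximal[OF Q(1) True] lw by auto
      ultimately have ball: "ball_like D (demazure_boundary Q v) d" using IHv by auto
      show ?thesis
      proof (cases "dem Q = w")
        case eq: True
        have "demazure_boundary Q v = L"
        proof (intro Set.set_eqI iffI)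
          fix F assume F: "F \<in> demazure_boundary Q v"
          then have FD: "F \<in> D" by (simp add: demazure_boundary_iff D_def)
          have "dem (word Q F) = w \<or> dem (word Q F) = w \<otimes> s"
            using FD eq
            by (intro dem_sandwich[OF word_in_lists[OF Q(1)] Q(1) _ w Q(2) down])
              (auto simp: D_def subword_complex_iff v_def subseq_conv_nths)
          then show "F \<in> L" using Lw[OF FD] F by (auto simp: demazure_boundary_iff v_def)
        next
          fix F assume "F \<in> L"
          then show "F \<in> demazure_boundary Q v" using LD Lv by (auto simp: demazure_boundary_iff D_def)
        qed
        then have "sphere_like K (Suc d)"
          unfolding K using ball_Un_cone_boundary[OF Dc Lc LD V(2)] ball by simp
        then show ?thesis using d eq dem[OF Q(1)] unfolding K_def by (intro exI[of _ "Suc d"]) simp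
      next
        case ne: False
        then obtain k where k: "d = Suc k" and ballL: "ball_like L (demazure_boundary Q w) k"
          using IHw by blast
        define M where "M = {F \<in> D. dem (word Q F) \<noteq> w \<and> dem (word Q F) \<noteq> v}"
        have M: "complex_on {..<n} M"
          unfolding complex_on_def
        proof (intro conjI ballI allI impI)
          show "M \<subseteq> Pow {..<n}" using Dc by (auto simp: M_def complex_on_def)
          fix F F' assume F: "F \<in> M" "F' \<subseteq> F"
          then have "F' \<in> D" using Dc by (auto simp: M_def complex_on_def)
          moreover have "dem (word Q F') \<noteq> w \<and> dem (word Q F') \<noteq> v"
            using F dem_sandwich[OF word_in_lists word_in_lists word_antimono[OF F(2)] w Q(2) down]
              Q(1) by (auto simp: M_def D_def subword_complex_iff v_def)
          ultimately show "F' \<in> M" by (simp add: M_def)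
        qed
        have bdD: "demazure_boundary Q v = L \<union> M"
          using LD Lv Lw by (auto simp: demazure_boundary_iff M_def D_def)
        have LM: "L \<inter> M \<subseteq> demazure_boundary Q w" by (auto simp: demazure_boundary_iff M_def L_def)
        have bdK: "demazure_boundary (Q @ [s]) w = {F \<in> D \<union> cone_complex n L.
            if F - {n} \<in> L then F - {n} \<in> demazure_boundary Q w else F \<in> demazure_boundary Q v}"
        proof (intro Set.set_eqI)
          fix F
          have "dem (word (Q @ [s]) F) \<noteq> w \<longleftrightarrow>
            (if F - {n} \<in> L then F - {n} \<in> demazure_boundary Q w else F \<in> demazure_boundary Q v)"
            if F: "F \<in> K"
          proof (cases "n \<in> F")
            case True
            then have "F - {n} \<in> L" using F Dn cone_complex_iff[OF Lc V(2)] unfolding K by blast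
            then show ?thesis using True
              by (simp add: demazure_boundary_iff word_snoc L_def flip: n_def)
          next
            case False
            then have "F - {n} = F" by auto
            then have FD: "F \<in> D" using F LD cone_complex_iff[OF Lc V(2), of F] unfolding K by auto
            have "dem (word (Q @ [s]) F) = w \<longleftrightarrow> dem (word Q F) = w \<or> dem (word Q F) = v"
              using word_D[OF False] dem[OF word_in_lists[OF Q(1)]] by simp
            then show ?thesis
              using FD Lv[of F] Lw[OF FD] \<open>F - {n} = F\<close>
              by (auto simp: demazure_boundary_iff L_def D_def)
          qed
          then show "F \<in> demazure_boundary (Q @ [s]) w \<longleftrightarrow> F \<in> {F \<in> D \<union> cone_complex n L.
            if F - {n} \<in> L then F - {n} \<in> demazure_boundary Q w else F \<in> demazure_boundary Q v}"
            unfolding demazure_boundary_iff[of F "Q @ [s]"] K_def[symmetric] K[symmetric] by blast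
        qed
        have "ball_like K (demazure_boundary (Q @ [s]) w) (Suc k)"
          unfolding bdK K
          by (rule ball_Un_cone_ball[OF V(1) Dc Lc LD V(2) ball[unfolded k] ballL M bdD LM])
        then show ?thesis
          using d k ne dem[OF Q(1)] \<open>dem Q \<noteq> v\<close> unfolding K_def by (intro exI[of _ "Suc d"]) simp
      qed
    qed
  qed
qed

section \<open>Facets and boundary facets\<close>

lemma length_word: "F \<subseteq> {..<length Q} \<Longrightarrow> length (word Q F) = length Q - card F"
proof -
  assume F: "F \<subseteq> {..<length Q}"
  have "{i. i < length Q \<and> i \<in> - F} = {..<length Q} - F" by auto
  then show ?thesis using F by (simp add: length_nths card_Diff_subset finite_subset)
qed

lemma subseq_word_imp_face:
  assumes "subseq v (word Q F)" "F \<subseteq> {..<length Q}"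
  obtains H where "F \<subseteq> H" "H \<subseteq> {..<length Q}" "word Q H = v"
proof -
  obtain N where "v = nths (nths Q (- F)) N" using assms subseq_conv_nths by blast
  then obtain B where B: "v = nths Q B" "B \<subseteq> - F" unfolding nths_nths by blast
  have "word Q ({..<length Q} - B) = v" unfolding B by (rule nths_cong) auto
  then show thesis using that[of "{..<length Q} - B"] B(2) assms(2) by blast
qed

lemma represents_imp_contains: "represents G S v w \<Longrightarrow> contains G S v w"
  by (auto simp: contains_def)

text \<open>If the complement of \<open>F\<close> contains \<open>w\<close> without representing it, discarding the letters outside a representing
  subword enlarges \<open>F\<close>.\<close>

lemma is_facet_iff:
  assumes Q: "Q \<in> lists S"
  shows "is_facet (subword_complex G S Q w) F \<longleftrightarrow> F \<subseteq> {..<length Q} \<and> represents G S (word Q F) w"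
proof
  assume F: "is_facet (subword_complex G S Q w) F"
  then have FU: "F \<subseteq> {..<length Q}" and "contains G S (word Q F) w"
    by (auto simp: is_facet_def subword_complex_iff)
  then obtain v where v: "subseq v (word Q F)" "represents G S v w" by (auto simp: contains_def)
  then obtain H where H: "F \<subseteq> H" "H \<subseteq> {..<length Q}" "word Q H = v"
    using subseq_word_imp_face FU by blast
  then have "H \<in> subword_complex G S Q w"
    using v represents_imp_contains by (simp add: subword_complex_iff)
  then have "H = F" using F H by (auto simp: is_facet_def)
  then show "F \<subseteq> {..<length Q} \<and> represents G S (word Q F) w" using FU H v by simp
next
  assume F: "F \<subseteq> {..<length Q} \<and> represents G S (word Q F) w"
  have "H = F" if "H \<in> subword_complex G S Q w" "F \<subseteq> H" for H
  proof -
    have H: "H \<subseteq> {..<length Q}" "contains G S (word Q H) w"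
      using that by (auto simp: subword_complex_iff)
    have fin: "finite H" using H finite_subset by blast
    have "len w \<le> length (word Q H)" using contains_len_le[OF H(2) word_in_lists[OF Q]] .
    then have "length Q - card F \<le> length Q - card H"
      using F H length_word[of F Q] length_word[of H Q] by (simp add: represents_def)
    moreover have "card H \<le> length Q" using card_mono[OF _ H(1)] by simp
    moreover have "card F \<le> card H" using card_mono[OF fin that(2)] .
    ultimately have "card H \<le> card F" by linarith
    then show ?thesis using card_seteq[OF fin that(2)] by simp
  qed
  then show "is_facet (subword_complex G S Q w) F"
    using F represents_imp_contains by (auto simp: is_facet_def subword_complex_iff)
qed

lemma Max_card_subword_complex:
  assumes Q: "Q \<in> lists S" and c: "contains G S Q w"
  shows "Max (card ` subword_complex G S Q w) = length Q - len w"
proof (rule Max_eqI)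
  have "subword_complex G S Q w \<subseteq> Pow {..<length Q}" by (auto simp: subword_complex_iff)
  then show "finite (card ` subword_complex G S Q w)"
    by (intro finite_imageI) (rule finite_subset, auto)
next
  fix k assume "k \<in> card ` subword_complex G S Q w"
  then obtain F where F: "k = card F" "F \<in> subword_complex G S Q w" by blast
  then have FU: "F \<subseteq> {..<length Q}" "contains G S (word Q F) w" by (auto simp: subword_complex_iff)
  have "len w \<le> length Q - card F"
    using contains_len_le[OF FU(2) word_in_lists[OF Q]] length_word[OF FU(1)] by simp
  moreover have "card F \<le> length Q" using card_mono[OF _ FU(1)] by simp
  ultimately show "k \<le> length Q - len w" using F by linarith
next
  obtain v where v: "subseq v Q" "represents G S v w" using c by (auto simp: contains_def)
  have "word Q {} = Q" by (simp add: nths_all)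
  then obtain H where H: "H \<subseteq> {..<length Q}" "word Q H = v"
    using subseq_word_imp_face[of v Q "{}"] v by auto
  have "len w = length Q - card H" using length_word[OF H(1)] H v by (simp add: represents_def)
  moreover have "card H \<le> length Q" using card_mono[OF _ H(1)] by simp
  ultimately have "card H = length Q - len w" by linarith
  moreover have "H \<in> subword_complex G S Q w"
    using H v represents_imp_contains by (simp add: subword_complex_iff)
  ultimately show "length Q - len w \<in> card ` subword_complex G S Q w" by (metis imageI)
qed

text \<open>The facets above \<open>R\<close> arise by adding one position to \<open>R\<close>, that is by deleting one letter of the complementary
  word; then \<open>delete_unique_iff_reduced\<close> counts them.\<close>

lemma unique_facet_iff:
  assumes Q: "Q \<in> lists S" and R: "R \<in> subword_complex G S Q w"
    and l: "length (word Q R) = Suc (len w)"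
  shows "(\<exists>!F. is_facet (subword_complex G S Q w) F \<and> R \<subseteq> F) \<longleftrightarrow>
    len (wp (word Q R)) = length (word Q R)"
proof -
  define v where "v = word Q R"
  have RU: "R \<subseteq> {..<length Q}" and c: "contains G S v w"
    using R by (auto simp: subword_complex_iff v_def)
  obtain e where e: "bij_betw e {..<length v} (- R \<inter> {..<length Q})"
    and del: "\<And>i. i < length v \<Longrightarrow> nths Q (- R - {e i}) = delete_nth i v"
    unfolding v_def using nths_delete_enumeration[of Q "- R"] by blast
  have word: "word Q (insert (e i) R) = delete_nth i v" if "i < length v" for i
  proof -
    have "- insert (e i) R = - R - {e i}" by auto
    then show ?thesis using del[OF that] by simp
  qed
  have rng: "e i \<notin> R" "e i < length Q" if "i < length v" for i
    using bij_betwE[OF e] that by auto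
  let ?A = "{i. i < length v \<and> wp (delete_nth i v) = w}"
  let ?B = "{F. is_facet (subword_complex G S Q w) F \<and> R \<subseteq> F}"
  have "bij_betw (\<lambda>i. insert (e i) R) ?A ?B"
    unfolding bij_betw_def
  proof
    show "inj_on (\<lambda>i. insert (e i) R) ?A"
    proof (rule inj_onI)
      fix i j assume ij: "i \<in> ?A" "j \<in> ?A" "insert (e i) R = insert (e j) R"
      then have lt: "i < length v" "j < length v" by simp_all
      have "e i \<in> insert (e j) R" using ij(3) by blast
      then have "e i = e j" using rng(1)[OF lt(1)] by blast
      then show "i = j" using inj_onD[OF bij_betw_imp_inj_on[OF e], of i j] lt by simp
    qed
    show "(\<lambda>i. insert (e i) R) ` ?A = ?B"
    proof
      show "(\<lambda>i. insert (e i) R) ` ?A \<subseteq> ?B"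
      proof
        fix F assume "F \<in> (\<lambda>i. insert (e i) R) ` ?A"
        then obtain i where i: "F = insert (e i) R" "i < length v" "wp (delete_nth i v) = w"
          by blast
        have "length (delete_nth i v) = len w" using i(2) l by (simp add: v_def)
        then have "represents G S (word Q F) w"
          using i word[OF i(2)] by (simp only: represents_def)
        moreover have "F \<subseteq> {..<length Q}" "R \<subseteq> F" using i(1) rng(2)[OF i(2)] RU by auto
        ultimately show "F \<in> ?B" unfolding mem_Collect_eq is_facet_iff[OF Q] by blast
      qed
      show "?B \<subseteq> (\<lambda>i. insert (e i) R) ` ?A"
      proof
        fix F assume "F \<in> ?B"
        then have F: "F \<subseteq> {..<length Q}" "represents G S (word Q F) w" "R \<subseteq> F"
          by (auto simp: is_facet_iff[OF Q])
        have fin: "finite F" "finite R" using F RU finite_subset by blast+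
        have "card F \<le> length Q" "card R \<le> length Q"
          using card_mono[OF _ F(1)] card_mono[OF _ RU] by auto
        moreover have "length Q - card F = len w" "length Q - card R = Suc (len w)"
          using F(2) l length_word[OF F(1)] length_word[OF RU] by (simp_all add: represents_def)
        ultimately have "card F = Suc (card R)" by linarith
        then have "card (F - R) = 1" using F(3) fin by (simp add: card_Diff_subset)
        then obtain p where p: "F - R = {p}" by (auto simp: card_1_singleton_iff)
        then have "p \<in> - R \<inter> {..<length Q}" using F by auto
        then obtain i where i: "i < length v" "p = e i"
          using bij_betw_imp_surj_on[OF e] by (metis imageE lessThan_iff)
        have Fi: "F = insert (e i) R" using p F(3) i by auto
        then have "wp (delete_nth i v) = w" using F(2) word[OF i(1)] by (simp add: represents_def)
        then show "F \<in> (\<lambda>i. insert (e i) R) ` ?A" using Fi i by blast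
      qed
    qed
  qed
  then have "card ?A = card ?B" by (rule bij_betw_same_card)
  then have "(\<exists>!F. is_facet (subword_complex G S Q w) F \<and> R \<subseteq> F) \<longleftrightarrow>
      (\<exists>!i. i < length v \<and> wp (delete_nth i v) = w)"
    unfolding card_eq_1_iff_ex1[symmetric] by simp
  also have "\<dots> \<longleftrightarrow> len (wp v) = length v"
    using delete_unique_iff_reduced[OF _ l[folded v_def] c] word_in_lists[OF Q] by (simp add: v_def)
  finally show ?thesis unfolding v_def .
qed

lemma is_boundary_facet_iff:
  assumes Q: "Q \<in> lists S" and c: "contains G S Q w"
  shows "is_boundary_facet (subword_complex G S Q w) R \<longleftrightarrow>
    R \<in> subword_complex G S Q w \<and> length (word Q R) = Suc (len w) \<and>
    represents G S (word Q R) (wp (word Q R))"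
proof (cases "R \<in> subword_complex G S Q w")
  case True
  then have RU: "R \<subseteq> {..<length Q}" by (simp add: subword_complex_iff)
  have "card R \<le> length Q" using card_mono[OF _ RU] by simp
  then have "card R + 1 = length Q - len w \<longleftrightarrow> length (word Q R) = Suc (len w)"
    using length_word[OF RU] by arith
  then show ?thesis
    using True unique_facet_iff[OF Q True]
    unfolding is_boundary_facet_def Max_card_subword_complex[OF Q c] represents_def by metis
qed (simp add: is_boundary_facet_def)

text \<open>A boundary facet above \<open>F\<close> is a reduced subword of the complement of \<open>F\<close> that contains \<open>w\<close> and has one more
  letter. It excludes \<open>dem (word Q F) = w\<close> by maximality of the Demazure product, and it exists
  otherwise by \<open>contains_cover\<close>.\<close>

lemma in_boundary_iff:
  assumes Q: "Q \<in> lists S" and c: "contains G S Q w" and F: "F \<in> subword_complex G S Q w"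
  shows "in_boundary (subword_complex G S Q w) F \<longleftrightarrow> dem (word Q F) \<noteq> w"
proof
  have FU: "F \<subseteq> {..<length Q}" and cF: "contains G S (word Q F) w"
    using F by (auto simp: subword_complex_iff)
  show "dem (word Q F) \<noteq> w" if bd: "in_boundary (subword_complex G S Q w) F"
  proof
    assume eq: "dem (word Q F) = w"
    obtain R where R: "is_boundary_facet (subword_complex G S Q w) R" "F \<subseteq> R"
      using bd by (auto simp: in_boundary_def)
    then have "represents G S (word Q R) (wp (word Q R))" and l: "length (word Q R) = Suc (len w)"
      using is_boundary_facet_iff[OF Q c] by auto
    then have "contains G S (word Q F) (wp (word Q R))" "len (wp (word Q R)) = Suc (len w)"
      using word_antimono[OF R(2), of Q] by (auto simp: contains_def represents_def)
    then show False using contains_maximal[OF word_in_lists[OF Q], of "- F" "wp (word Q R)"] eq by auto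
  qed
  assume "dem (word Q F) \<noteq> w"
  then obtain T where T: "subseq T (word Q F)" "represents G S T (wp T)" "length T = Suc (len w)"
      "contains G S T w"
    using contains_cover[OF word_in_lists[OF Q] cF] by blast
  obtain R where R: "F \<subseteq> R" "R \<subseteq> {..<length Q}" "word Q R = T"
    using subseq_word_imp_face[OF T(1) FU] by blast
  have "is_boundary_facet (subword_complex G S Q w) R"
    unfolding is_boundary_facet_iff[OF Q c] using R T by (simp add: subword_complex_iff)
  then show "in_boundary (subword_complex G S Q w) F" using R by (auto simp: in_boundary_def)
qed

end

theorem theorem3p7:
  fixes G :: "('a, 'b) monoid_scheme" and S :: "'a set" and Q :: "'a list" and \<pi> :: 'a
  assumes "coxeter_system G S"
    and "set Q \<subseteq> S"
    and "\<pi> \<in> carrier G"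
    and "contains G S Q \<pi>"
  shows "(is_ball (subword_complex G S Q \<pi>) \<or> is_sphere (subword_complex G S Q \<pi>)) \<and>
    (\<forall>P \<subseteq> {..<length Q}. {..<length Q} - P \<in> subword_complex G S Q \<pi> \<longrightarrow>
       (in_boundary (subword_complex G S Q \<pi>) ({..<length Q} - P) \<longleftrightarrow>
        demazure G S (nths Q P) \<noteq> \<pi>))"
proof -
  obtain m where G: "group G" "S \<subseteq> carrier G" "generate G S = carrier G" "coxeter_matrix S m"
    and pres: "\<forall>v\<in>lists S. \<forall>w\<in>lists S.
      word_prod G v = word_prod G w \<longleftrightarrow> equivclp (insert_relator S m) v w"
    using assms(1) unfolding coxeter_system_def by blast
  interpret group G by (rule G(1))
  interpret coxeter_group G S m
    by unfold_locales (use G pres in auto)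
  let ?K = "subword_complex G S Q \<pi>"
  have Q: "Q \<in> lists S" using assms(2) by auto
  have empty: "{} \<in> ?K" using assms(4) by (simp add: subword_complex_iff nths_all)
  note cplx = finite_lessThan subword_complex_complex empty
  have "is_ball ?K \<or> is_sphere ?K"
    using subword_complex_ball_or_sphere[OF Q assms(4)]
      ball_like_imp_is_ball[OF cplx] sphere_like_imp_is_sphere[OF cplx] by blast
  moreover have "in_boundary ?K ({..<length Q} - P) \<longleftrightarrow> demazure G S (nths Q P) \<noteq> \<pi>"
    if "{..<length Q} - P \<in> ?K" for P
  proof -
    have "nths Q P = word Q ({..<length Q} - P)" by (rule nths_cong) auto
    then show ?thesis using in_boundary_iff[OF Q assms(4) that] by simp
  qed
  ultimately show ?thesis by blast
qed

end
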